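(* Let $n\ge 1$, $\sigma>0$, $\alpha\in(0,1)$, and let $\boldsymbol{\mu}\in\mathcal S_n^\uparrow$. Observe $\mathbf y=\boldsymbol\mu+\boldsymbol\xi$ with $\boldsymbol\xi\sim\mathcal N(\mathbf 0,\sigma^2 I_{n\times n})$. Let $\hat{\boldsymbol\mu}=\Pi_{\mathcal S_n^\uparrow}(\mathbf y)$ be the least squares estimator over $\mathcal S_n^\uparrow$, let $\hat k=k(\hat{\boldsymbol\mu})$, and define $$\hat r_\uparrow=\frac{\sigma^2\hat k\,\big(2+22\log n+10\log(1/\alpha)\big)}{n}.$$ Then with probability at least $1-\alpha$, $$\frac1n\sum_{i=1}^n(\hat\mu_i-\mu_i)^2\le \hat r_\uparrow .$$
   Context: $\mathcal S_n^\uparrow=\{\mathbf u\in\mathbb R^n: u_1\le u_2\le\dots\le u_n\}$ (the cone of nondecreasing sequences; $\mathcal S_1^\uparrow=\mathbb R$). $\Pi_K$ denotes the Euclidean projection onto a closed convex set $K$, so $\Pi_{\mathcal S_n^\uparrow}(\mathbf y)=\arg\min_{\mathbf u\in\mathcal S_n^\uparrow}\|\mathbf y-\mathbf u\|_2^2$. For $\mathbf u\in\mathbb R^n$, $k(\mathbf u)=|\{u_1,\dots,u_n\}|$ is the number of distinct values of $\mathbf u$; for a nondecreasing $\mathbf u$ it is the number of constant pieces (one plus the number of strict inequalities $u_i<u_{i+1}$). $\log$ is the natural logarithm. *)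

theory Defs
  imports "HOL-Probability.Probability"
begin

text \<open>Vectors in R^n are represented as functions nat => real, with coordinates
  0..n-1 (index i corresponds to the paper's coordinate i+1).\<close>

definition mono_cone :: "nat \<Rightarrow> (nat \<Rightarrow> real) set" where
  "mono_cone n = {u \<in> extensional {0..<n}. \<forall>i j. i \<le> j \<and> j < n \<longrightarrow> u i \<le> u j}"

definition sqdist_n :: "nat \<Rightarrow> (nat \<Rightarrow> real) \<Rightarrow> (nat \<Rightarrow> real) \<Rightarrow> real" where
  "sqdist_n n y u = (\<Sum>i<n. (y i - u i)^2)"

definition proj_mono :: "nat \<Rightarrow> (nat \<Rightarrow> real) \<Rightarrow> (nat \<Rightarrow> real)" where
  "proj_mono n y = (THE u. u \<in> mono_cone n \<and> (\<forall>v \<in> mono_cone n. sqdist_n n y u \<le> sqdist_n n y v))"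

definition num_vals :: "nat \<Rightarrow> (nat \<Rightarrow> real) \<Rightarrow> nat" where
  "num_vals n u = card (u ` {0..<n})"

definition gauss_noise :: "nat \<Rightarrow> real \<Rightarrow> (nat \<Rightarrow> real) measure" where
  "gauss_noise n \<sigma> = PiM {0..<n} (\<lambda>_. density lborel (normal_density 0 \<sigma>))"

end

theory Submission
  imports Defs
begin

text \<open>On every constant block \<open>T\<close> of the fit, the KKT conditions make the error \<open>v\<close> a nonincreasing
  sequence with \<open>|v|\<^sup>2 \<le> \<langle>\<xi>\<^sub>T, v\<rangle>\<close>, so that \<open>|v|\<^sup>2\<close> is at most the energy \<open>Z\<close> of \<open>\<xi>\<^sub>T\<close>, its squared
  projection onto the nonincreasing cone. It remains to bound \<open>Z\<close> on all \<open>O(n\<^sup>2)\<close> windows at once.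

  The mean of \<open>Z\<close> is at most \<open>\<sigma>\<^sup>2 H\<^sub>m\<close> on a window of length \<open>m\<close>: slicing nonincreasing sequences into
  layers bounds \<open>Z\<close> by an integral over \<open>c\<close> of maxima of the random walks with steps \<open>\<plusminus>\<xi>\<^sub>j - c\<close>, whose
  means are given by Spitzer's identity. For the tail, Maurey's inequality for the Gaussian measure
  (Prekopa-Leindler on the line, then tensorization) gives \<open>E exp (Z / 8\<sigma>\<^sup>2) E exp (- Z / 4\<sigma>\<^sup>2) \<le> 1\<close>,
  hence \<open>E exp (Z / 8\<sigma>\<^sup>2) \<le> exp (H\<^sub>m / 4)\<close> by Jensen, and a union bound finishes the proof.\<close>

section \<open>Isotonic regression\<close>

text \<open>The blocks depend on the noise, so the noise on a block is not Gaussian. A union over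
  all fixed windows removes this dependence at the price of a factor n^2 in the failure probability.
  The exponents 1/8 and 1/4 come from halving a sequence inside the cone, which gives Z(x) \<le> 2
  Z(y) + 2 |x - y|^2. Divided by 8 \<sigma>^2, this has the Gaussian cost |x - y|^2 / (4 \<sigma>^2)
  on the right, the one for which Maurey's inequality holds. No dimension enters there; the window
  length is felt only through the mean of Z, hence the logarithm. If b is the bracket 2 + 22 log n +
  10 log (1/\<alpha>), one window fails with probability at most exp (H_m / 4 - b / 8). The 2
  absorbs the constant in H_m \<le> 1 + log n, while 22 and 10 leave room for n^2 and \<alpha>. A
  further obstacle is formal: \<open>measure\<close> is 0 on non-measurable sets and the fit is
  defined by \<open>THE\<close>, so the event has to be proved measurable. The min-max formula is
  there for that.\<close>

text \<open>The multipliers of the constraints \<open>u k \<le> u (Suc k)\<close> are the partial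
  sums of \<open>y - u\<close>: nonnegative, and zero at strict jumps. Equivalently, the cumulative
  sums of \<open>u\<close> are the greatest convex minorant of those of \<open>y\<close>.\<close>

definition isotonic_kkt :: "nat \<Rightarrow> (nat \<Rightarrow> real) \<Rightarrow> (nat \<Rightarrow> real) \<Rightarrow> bool" where
  "isotonic_kkt n y u \<longleftrightarrow>
     (\<forall>i j. i \<le> j \<and> j < n \<longrightarrow> u i \<le> u j) \<and>
     (\<forall>k\<le>n. (\<Sum>j<k. u j) \<le> (\<Sum>j<k. y j)) \<and>
     (\<Sum>j<n. u j) = (\<Sum>j<n. y j) \<and>
     (\<forall>k. Suc k < n \<and> u k < u (Suc k) \<longrightarrow> (\<Sum>j<Suc k. u j) = (\<Sum>j<Suc k. y j))"

lemma sum_lessThan_add: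
  fixes f :: "nat \<Rightarrow> 'a::comm_monoid_add"
  shows "(\<Sum>j<s + k. f j) = (\<Sum>j<s. f j) + (\<Sum>j<k. f (s + j))"
  by (induction k) (auto simp: add.assoc)

lemma sum_Ico_eq_diff:
  fixes f :: "nat \<Rightarrow> real"
  assumes "a \<le> b"
  shows "(\<Sum>j\<in>{a..<b}. f j) = (\<Sum>j<b. f j) - (\<Sum>j<a. f j)"
  using assms by (simp add: sum_diff_nat_ivl[of 0 a b f, simplified, symmetric] lessThan_atLeast0)

lemma summation_by_parts:
  fixes d v :: "nat \<Rightarrow> real"
  shows "(\<Sum>j<Suc m. d j * v j)
    = (\<Sum>j<Suc m. d j) * v m - (\<Sum>k<m. (\<Sum>j<Suc k. d j) * (v (Suc k) - v k))"
  by (induction m) (simp_all add: algebra_simps)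

text \<open>After summation by parts the boundary term vanishes; what remains is minus a sum of
  nonnegative partial sums times nonnegative increments.\<close>

lemma sum_mult_mono_nonpos:
  fixes d v :: "nat \<Rightarrow> real"
  assumes "\<And>k. k \<le> m \<Longrightarrow> 0 \<le> (\<Sum>j<k. d j)" "(\<Sum>j<m. d j) = 0"
    and "\<And>i j. i \<le> j \<Longrightarrow> j < m \<Longrightarrow> v i \<le> v j"
  shows "(\<Sum>j<m. d j * v j) \<le> 0"
proof (cases m)
  case (Suc l)
  have "0 \<le> (\<Sum>k<l. (\<Sum>j<Suc k. d j) * (v (Suc k) - v k))"
  proof (rule sum_nonneg)
    fix k assume "k \<in> {..<l}"
    then have "0 \<le> sum d {..<Suc k}" "0 \<le> v (Suc k) - v k"
      using assms(1)[of "Suc k"] assms(3)[of k "Suc k"] Suc by auto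
    then show "0 \<le> sum d {..<Suc k} * (v (Suc k) - v k)" by (rule mult_nonneg_nonneg)
  qed
  then show ?thesis
    using summation_by_parts[of d v l] assms(2) Suc by simp
qed simp

text \<open>Greedy construction: the first block is the longest prefix of least mean, the rest is
  solved recursively. The induction also carries that \<open>u 0\<close> is a prefix mean of
  \<open>y\<close>, which is what places the next block above the current one.\<close>

lemma isotonic_kkt_exists: "\<exists>u. isotonic_kkt n y u"
proof -
  have "\<exists>u. isotonic_kkt n y u \<and>
     (n > 0 \<longrightarrow> (\<exists>k. 0 < k \<and> k \<le> n \<and> real k * u 0 = (\<Sum>j<k. y j)))"
  proof (induction n arbitrary: y rule: less_induct)
    case (less n)
    show ?case
    proof (cases "n = 0")
      case True
      then show ?thesis by (auto simp: isotonic_kkt_def)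
    next
      case False
      define S where "S k = (\<Sum>j<k. y j)" for k
      define c where "c = Min ((\<lambda>k. S k / real k) ` {1..n})"
      \<comment> \<open>Ties go to the longest prefix, so all longer prefix sums lie strictly above
        the line of slope \<open>c\<close>.\<close>
      define t where "t = Max {k\<in>{1..n}. S k = c * real k}"
      have c_le: "c * real k \<le> S k" if "k \<le> n" for k
      proof (cases "k = 0")
        case False
        then have "c \<le> S k / real k"
          unfolding c_def using that by (intro Min_le) auto
        with False show ?thesis by (simp add: field_simps)
      qed (simp add: S_def)
      have "c \<in> (\<lambda>k. S k / real k) ` {1..n}"
        unfolding c_def using False by (intro Min_in) auto
      then have ne: "{k\<in>{1..n}. S k = c * real k} \<noteq> {}"
        by (auto simp: field_simps)
      have "t \<in> {k\<in>{1..n}. S k = c * real k}"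
        unfolding t_def using ne by (intro Max_in) auto
      then have t: "1 \<le> t" "t \<le> n" "S t = c * real t" by auto
      have gt: "c * real k < S k" if "t < k" "k \<le> n" for k
      proof -
        have "S k \<noteq> c * real k"
        proof
          assume "S k = c * real k"
          then have "k \<le> t" unfolding t_def using that by (intro Max_ge) auto
          with that show False by simp
        qed
        with c_le[of k] that show ?thesis by simp
      qed
      obtain u' where u': "isotonic_kkt (n - t) (\<lambda>j. y (t + j)) u'"
        "n - t > 0 \<Longrightarrow> \<exists>k. 0 < k \<and> k \<le> n - t \<and> real k * u' 0 = (\<Sum>j<k. y (t + j))"
        using less.IH[of "n - t" "\<lambda>j. y (t + j)"] t False by auto
      note kkt = u'(1)[unfolded isotonic_kkt_def]
      have lt: "c < u' 0" if tn: "t < n"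
      proof -
        obtain k where k: "0 < k" "k \<le> n - t" "real k * u' 0 = (\<Sum>j<k. y (t + j))"
          using u'(2) tn by auto
        have "S (t + k) = S t + (\<Sum>j<k. y (t + j))"
          unfolding S_def by (rule sum_lessThan_add)
        \<comment> \<open>The sum of length \<open>t\<close> lies on the line of slope
          \<open>c\<close> and the one of length \<open>t + k\<close> above it, so the
          \<open>k\<close> entries in between have mean above \<open>c\<close>.\<close>
        moreover have "c * real (t + k) < S (t + k)" using gt[of "t + k"] k tn by simp
        ultimately have "c * real k < real k * u' 0" using k t by (simp add: algebra_simps)
        then have "real k * c < real k * u' 0" by (simp only: mult.commute)
        then show ?thesis using k(1) by simp
      qed
      define u where "u j = (if j < t then c else u' (j - t))" for j
      have U0: "(\<Sum>j<k. u j) = c * real k" if "k \<le> t" for k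
        using that by (simp add: u_def)
      have U1: "(\<Sum>j<t + k. u j) = c * real t + (\<Sum>j<k. u' j)" for k
        by (simp add: sum_lessThan_add U0) (simp add: u_def)
      have S1: "S (t + k) = c * real t + (\<Sum>j<k. y (t + j))" for k
        using t by (simp add: S_def sum_lessThan_add)
      have "isotonic_kkt n y u"
        unfolding isotonic_kkt_def
      proof (intro conjI allI impI)
        fix i j assume ij: "i \<le> j \<and> j < n"
        consider "j < t" | "i < t" "t \<le> j" | "t \<le> i" using ij by linarith
        then show "u i \<le> u j"
        proof cases
          case 2
          have "c \<le> u' 0" using lt ij 2 by simp
          also have "u' 0 \<le> u' (j - t)" using kkt ij 2 by auto
          finally show ?thesis using 2 by (simp add: u_def)
        next
          case 3
          have "i - t \<le> j - t" "j - t < n - t" using ij 3 by auto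
          then have "u' (i - t) \<le> u' (j - t)" using kkt by blast
          then show ?thesis using 3 ij by (simp add: u_def)
        qed (use ij in \<open>simp add: u_def\<close>)
      next
        fix k assume k: "k \<le> n"
        show "(\<Sum>j<k. u j) \<le> (\<Sum>j<k. y j)"
        proof (cases "k \<le> t")
          case True
          then show ?thesis using U0[of k] c_le[of k] k by (simp add: S_def)
        next
          case False
          have "(\<Sum>j<k - t. u' j) \<le> (\<Sum>j<k - t. y (t + j))" using kkt k by auto
          then show ?thesis using U1[of "k - t"] S1[of "k - t"] False by (simp add: S_def)
        qed
      next
        show "(\<Sum>j<n. u j) = (\<Sum>j<n. y j)"
          using U1[of "n - t"] S1[of "n - t"] kkt t by (simp add: S_def)
      next
        fix k assume k: "Suc k < n \<and> u k < u (Suc k)"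
        consider "Suc k < t" | "Suc k = t" | "t \<le> k" by linarith
        then show "(\<Sum>j<Suc k. u j) = (\<Sum>j<Suc k. y j)"
        proof cases
          case 1
          then show ?thesis using k by (simp add: u_def)
        next
          case 2
          then show ?thesis using U0[of t] t by (simp add: S_def)
        next
          case 3
          then have "u' (k - t) < u' (Suc (k - t))" using k by (simp add: u_def Suc_diff_le)
          then have "(\<Sum>j<Suc (k - t). u' j) = (\<Sum>j<Suc (k - t). y (t + j))"
            using kkt k 3 by (metis Suc_diff_le diff_less_mono le_SucI)
          then show ?thesis
            using U1[of "Suc (k - t)"] S1[of "Suc (k - t)"] 3 by (simp add: S_def)
        qed
      qed
      moreover have "real t * u 0 = (\<Sum>j<t. y j)" using t by (simp add: u_def S_def)
      ultimately show ?thesis using t by (intro exI[of _ u]) (auto intro!: exI[of _ t])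
    qed
  qed
  then show ?thesis by blast
qed

section \<open>From the KKT conditions to the projection and its blocks\<close>

text \<open>Complementary slackness: after summation by parts, each product of a partial sum with an
  increment has a zero factor.\<close>

lemma isotonic_kkt_orthogonal:
  assumes "isotonic_kkt n y u"
  shows "(\<Sum>j<n. (y j - u j) * u j) = 0"
proof (cases n)
  case (Suc m)
  note kkt = assms[unfolded isotonic_kkt_def]
  have "(\<Sum>k<m. (\<Sum>j<Suc k. y j - u j) * (u (Suc k) - u k)) = 0"
  proof (intro sum.neutral ballI)
    fix k assume k: "k \<in> {..<m}"
    then have "u k \<le> u (Suc k)" using kkt Suc by auto
    moreover have "(\<Sum>j<Suc k. y j - u j) = 0" if "u k < u (Suc k)"
      using that kkt Suc k by (simp add: sum_subtractf)
    ultimately show "(\<Sum>j<Suc k. y j - u j) * (u (Suc k) - u k) = 0"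
      by (cases "u k = u (Suc k)") auto
  qed
  moreover have "(\<Sum>j<Suc m. y j - u j) = 0" using kkt Suc by (simp add: sum_subtractf)
  ultimately show ?thesis using summation_by_parts[of "\<lambda>j. y j - u j" u m] Suc by simp
qed simp

text \<open>The residual is orthogonal to \<open>u\<close> and correlates nonpositively with every
  \<open>v\<close> of the cone. The extra term \<open>sqdist_n n u v\<close> yields minimality and
  uniqueness together.\<close>

lemma isotonic_kkt_pythagoras:
  assumes "isotonic_kkt n y u" and v: "\<forall>i j. i \<le> j \<and> j < n \<longrightarrow> v i \<le> v j"
  shows "sqdist_n n y u + sqdist_n n u v \<le> sqdist_n n y v"
proof -
  note kkt = assms(1)[unfolded isotonic_kkt_def]
  have "(\<Sum>j<n. (y j - u j) * v j) \<le> 0"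
    by (rule sum_mult_mono_nonpos) (use kkt v in \<open>auto simp: sum_subtractf\<close>)
  moreover have "sqdist_n n y v - sqdist_n n y u - sqdist_n n u v
      = 2 * (\<Sum>j<n. (y j - u j) * u j) - 2 * (\<Sum>j<n. (y j - u j) * v j)"
    unfolding sqdist_n_def sum_distrib_left sum_subtractf[symmetric]
    by (intro sum.cong) (auto simp: power2_eq_square algebra_simps)
  ultimately show ?thesis using isotonic_kkt_orthogonal[OF assms(1)] by simp
qed

text \<open>The Pythagorean gap forces any minimizer to agree with \<open>u\<close> below
  \<open>n\<close>, and membership in \<open>mono_cone\<close> fixes the values beyond, so
  \<open>THE\<close> is well defined.\<close>

lemma proj_mono_eq:
  assumes "isotonic_kkt n y u"
  shows "proj_mono n y = restrict u {0..<n}"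
  unfolding proj_mono_def
proof (rule the_equality)
  let ?u = "restrict u {0..<n}"
  note kkt = assms[unfolded isotonic_kkt_def]
  have sq: "sqdist_n n y ?u = sqdist_n n y u" by (auto simp: sqdist_n_def intro!: sum.cong)
  have cone: "?u \<in> mono_cone n" using kkt by (auto simp: mono_cone_def)
  have opt: "sqdist_n n y ?u + sqdist_n n u v \<le> sqdist_n n y v" if "v \<in> mono_cone n" for v
    using isotonic_kkt_pythagoras[OF assms, of v] that sq by (auto simp: mono_cone_def)
  have nn: "0 \<le> sqdist_n n u v" for v by (simp add: sqdist_n_def sum_nonneg)
  show "?u \<in> mono_cone n \<and> (\<forall>v\<in>mono_cone n. sqdist_n n y ?u \<le> sqdist_n n y v)"
  proof (intro conjI ballI cone)
    fix v assume "v \<in> mono_cone n"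
    from opt[OF this] nn[of v] show "sqdist_n n y ?u \<le> sqdist_n n y v" by linarith
  qed
  fix w assume w: "w \<in> mono_cone n \<and> (\<forall>v\<in>mono_cone n. sqdist_n n y w \<le> sqdist_n n y v)"
  then have "sqdist_n n y w \<le> sqdist_n n y ?u" using cone by blast
  with opt[of w] w have "sqdist_n n u w \<le> 0" by simp
  with nn[of w] have "sqdist_n n u w = 0" by simp
  then have "\<forall>i<n. u i = w i" by (auto simp: sqdist_n_def sum_nonneg_eq_0_iff)
  moreover have "w \<in> extensional {0..<n}" using w by (auto simp: mono_cone_def)
  ultimately show "w = ?u" by (auto simp: extensional_def restrict_def fun_eq_iff)
qed

text \<open>At each end of a level set either \<open>u\<close> jumps strictly or the index range
  stops; in both cases the cumulative sums agree, so \<open>u i\<close> is the mean of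
  \<open>y\<close> over its block.\<close>

lemma isotonic_kkt_block:
  assumes kkt: "isotonic_kkt n y u" and i: "i < n"
  obtains s t where "s \<le> i" "i < t" "t \<le> n" "{j. j < n \<and> u j = u i} = {s..<t}"
    "(\<Sum>j<s. u j) = (\<Sum>j<s. y j)" "(\<Sum>j<t. u j) = (\<Sum>j<t. y j)"
proof -
  note kkt' = kkt[unfolded isotonic_kkt_def]
  have mono: "\<And>a b. a \<le> b \<Longrightarrow> b < n \<Longrightarrow> u a \<le> u b" using kkt' by auto
  let ?B = "{j. j < n \<and> u j = u i}"
  have fin: "finite ?B" and ne: "?B \<noteq> {}" using i by auto
  define s where "s = Min ?B"
  define t where "t = Suc (Max ?B)"
  have s: "s < n" "u s = u i" using Min_in[OF fin ne] by (auto simp: s_def)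
  have t: "t \<le> n" "u (t - 1) = u i" using Max_in[OF fin ne] by (auto simp: t_def)
  have si: "s \<le> i" "i < t" using i fin by (auto simp: s_def t_def less_Suc_eq_le)
  have "?B = {s..<t}"
  proof (intro equalityI subsetI)
    fix j assume "j \<in> ?B"
    then show "j \<in> {s..<t}" using fin by (auto simp: s_def t_def less_Suc_eq_le)
  next
    fix j assume j: "j \<in> {s..<t}"
    then have "u s \<le> u j" "u j \<le> u (t - 1)" using t mono[of s j] mono[of j "t - 1"] by auto
    then show "j \<in> ?B" using s t j by auto
  qed
  note B = this
  moreover have "(\<Sum>j<s. u j) = (\<Sum>j<s. y j)"
  proof (cases s)
    case (Suc k)
    have "k \<notin> ?B" unfolding B using Suc by simp
    then have "u k < u (Suc k)" using s Suc mono[of k s] by auto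
    then show ?thesis using kkt' s Suc by blast
  qed simp
  moreover have "(\<Sum>j<t. u j) = (\<Sum>j<t. y j)"
  proof (cases "t = n")
    case True
    then show ?thesis using kkt' by simp
  next
    case False
    obtain k where k: "t = Suc k" by (simp add: t_def)
    have "t \<notin> ?B" unfolding B by simp
    then have "u k < u (Suc k)" using t k mono[of k t] False by auto
    moreover have "Suc k < n" using t k False by simp
    ultimately show ?thesis using kkt' k by blast
  qed
  ultimately show ?thesis using that[of s t] si t(1) by simp
qed

text \<open>The block \<open>{s..<t}\<close> of \<open>i\<close> is a saddle point: windows ending
  at \<open>t\<close> have mean at most \<open>u i\<close>, windows starting at \<open>s\<close> at
  least \<open>u i\<close>. A closed form by finitely many averages makes the projection measurable
  in the data.\<close>

lemma isotonic_kkt_min_max: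
  assumes kkt: "isotonic_kkt n y u" and i: "i < n"
  shows "u i = Max ((\<lambda>a. Min ((\<lambda>b. (\<Sum>j\<in>{a..<b}. y j) / real (b - a)) ` {i<..n})) ` {..i})"
proof -
  obtain s t where st: "s \<le> i" "i < t" "t \<le> n" "{j. j < n \<and> u j = u i} = {s..<t}"
    "(\<Sum>j<s. u j) = (\<Sum>j<s. y j)" "(\<Sum>j<t. u j) = (\<Sum>j<t. y j)"
    by (rule isotonic_kkt_block[OF assms])
  note kkt' = kkt[unfolded isotonic_kkt_def]
  have mono: "\<And>a b. a \<le> b \<Longrightarrow> b < n \<Longrightarrow> u a \<le> u b" using kkt' by auto
  let ?A = "\<lambda>a b. (\<Sum>j\<in>{a..<b}. y j) / real (b - a)"
  have block: "j < n \<and> u j = u i" if "s \<le> j" "j < t" for j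
  proof -
    have "j \<in> {s..<t}" using that by simp
    then show ?thesis unfolding st(4)[symmetric] by simp
  qed
  have upper: "?A a t \<le> u i" if "a \<le> i" for a
  proof -
    have "(\<Sum>j\<in>{a..<t}. y j) \<le> (\<Sum>j\<in>{a..<t}. u j)"
    proof -
      have "(\<Sum>j<a. u j) \<le> (\<Sum>j<a. y j)" using kkt' that i by auto
      then show ?thesis using st(2,6) that by (simp add: sum_Ico_eq_diff)
    qed
    also have "\<dots> \<le> (\<Sum>j\<in>{a..<t}. u i)"
    proof (rule sum_mono)
      fix j assume j: "j \<in> {a..<t}"
      then have "s \<le> j \<and> j < t \<or> j \<le> i" using st(1) by auto
      then show "u j \<le> u i" using block[of j] mono[of j i] i by auto
    qed
    finally show ?thesis using that st(1,2) by (simp add: field_simps)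
  qed
  have lower: "u i \<le> ?A s b" if "i < b" "b \<le> n" for b
  proof -
    have "(\<Sum>j\<in>{s..<b}. u i) \<le> (\<Sum>j\<in>{s..<b}. u j)"
    proof (rule sum_mono)
      fix j assume j: "j \<in> {s..<b}"
      then have "s \<le> j \<and> j < t \<or> i \<le> j" using st(2) by auto
      then show "u i \<le> u j" using block[of j] mono[of i j] j that by auto
    qed
    also have "\<dots> \<le> (\<Sum>j\<in>{s..<b}. y j)"
    proof -
      have "(\<Sum>j<b. u j) \<le> (\<Sum>j<b. y j)" using kkt' that by auto
      then show ?thesis using st(1,5) that by (simp add: sum_Ico_eq_diff)
    qed
    finally show ?thesis using that st(1,2) by (simp add: field_simps)
  qed
  have "Min (?A a ` {i<..n}) \<le> u i" if "a \<le> i" for a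
  proof -
    have "Min (?A a ` {i<..n}) \<le> ?A a t" using st(2,3) by (intro Min_le) auto
    also note upper[OF that]
    finally show ?thesis .
  qed
  then have "Max ((\<lambda>a. Min (?A a ` {i<..n})) ` {..i}) \<le> u i"
    by (intro Max.boundedI) auto
  moreover have "u i \<le> Min (?A s ` {i<..n})" using lower i by (intro Min.boundedI) auto
  then have "u i \<le> Max ((\<lambda>a. Min (?A a ` {i<..n})) ` {..i})"
  proof (rule order_trans)
    show "Min (?A s ` {i<..n}) \<le> Max ((\<lambda>a. Min (?A a ` {i<..n})) ` {..i})"
    using st(1) by (intro Max_ge) auto
  qed
  ultimately show ?thesis by (rule antisym[rotated])
qed

text \<open>On a block the fit is the constant block mean and the partial sums of the residuals stay
  nonnegative, so the monotone \<open>\<mu>\<close> correlates nonpositively with the residuals.\<close>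

lemma isotonic_kkt_block_error:
  assumes kkt: "isotonic_kkt n (\<lambda>j. \<mu> j + \<xi> j) u" and \<mu>: "\<forall>i j. i \<le> j \<and> j < n \<longrightarrow> \<mu> i \<le> \<mu> j"
    and i: "i < n"
  obtains s m where "s + m \<le> n" "{j. j < n \<and> u j = u i} = {s..<s + m}"
    "\<And>j k. j \<le> k \<Longrightarrow> k < m \<Longrightarrow> u (s + k) - \<mu> (s + k) \<le> u (s + j) - \<mu> (s + j)"
    "(\<Sum>j<m. (u (s + j) - \<mu> (s + j))\<^sup>2) \<le> (\<Sum>j<m. \<xi> (s + j) * (u (s + j) - \<mu> (s + j)))"
proof -
  obtain s t where st: "s \<le> i" "i < t" "t \<le> n" "{j. j < n \<and> u j = u i} = {s..<t}"
    "(\<Sum>j<s. u j) = (\<Sum>j<s. \<mu> j + \<xi> j)" "(\<Sum>j<t. u j) = (\<Sum>j<t. \<mu> j + \<xi> j)"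
    by (rule isotonic_kkt_block[OF kkt i])
  define m where "m = t - s"
  have t: "t = s + m" using st(1,2) by (simp add: m_def)
  note kkt' = kkt[unfolded isotonic_kkt_def]
  have const: "u (s + j) = u i" if "j < m" for j
  proof -
    have "s + j \<in> {s..<t}" using that t by simp
    then show ?thesis unfolding st(4)[symmetric] by simp
  qed
  define d where "d j = \<mu> (s + j) + \<xi> (s + j) - u (s + j)" for j
  have D: "(\<Sum>j<k. d j) = (\<Sum>j<s + k. \<mu> j + \<xi> j) - (\<Sum>j<s + k. u j)" for k
    using st(5) by (simp add: d_def sum_lessThan_add sum_subtractf)
  have D0: "(\<Sum>j<m. d j) = 0" using D[of m] st(6) t by simp
  have "(\<Sum>j<m. d j * \<mu> (s + j)) \<le> 0"
  proof (rule sum_mult_mono_nonpos)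
    fix k assume "k \<le> m"
    then have "(\<Sum>j<s + k. u j) \<le> (\<Sum>j<s + k. \<mu> j + \<xi> j)" using kkt' st(3) t by auto
    then show "0 \<le> (\<Sum>j<k. d j)" by (simp add: D)
  qed (use D0 \<mu> st(3) t in auto)
  moreover have "(\<Sum>j<m. d j * u (s + j)) = (\<Sum>j<m. d j) * u i"
    unfolding sum_distrib_right using const by (intro sum.cong) auto
  \<comment> \<open>Since \<open>d\<close> is the noise minus \<open>u - \<mu>\<close>, the gap is
    the inner product of \<open>d\<close> with \<open>u - \<mu>\<close>; its \<open>u\<close> part
    vanishes because \<open>u\<close> is constant and \<open>d\<close> sums to zero on the
    block.\<close>
  moreover have "(\<Sum>j<m. \<xi> (s + j) * (u (s + j) - \<mu> (s + j))) - (\<Sum>j<m. (u (s + j) - \<mu> (s + j))\<^sup>2)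
      = (\<Sum>j<m. d j * u (s + j)) - (\<Sum>j<m. d j * \<mu> (s + j))"
    unfolding sum_subtractf[symmetric] d_def
    by (intro sum.cong) (auto simp: power2_eq_square algebra_simps)
  ultimately have "(\<Sum>j<m. (u (s + j) - \<mu> (s + j))\<^sup>2) \<le> (\<Sum>j<m. \<xi> (s + j) * (u (s + j) - \<mu> (s + j)))"
    using D0 by simp
  moreover have "u (s + k) - \<mu> (s + k) \<le> u (s + j) - \<mu> (s + j)" if "j \<le> k" "k < m" for j k
    using const[of j] const[of k] \<mu> that st(3) t by auto
  ultimately show ?thesis using that[of s m] st(3,4) t by simp
qed

section \<open>Maurey's inequality for Gaussian product measures\<close>

text \<open>Cutting at points of \<open>A\<close> itself gives truncations that contain their
  maximum, which is what the Brunn-Minkowski argument needs without any compactness.\<close>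

lemma emeasure_eq_SUP_atMost:
  fixes A :: "real set"
  assumes [measurable]: "A \<in> sets borel" and "A \<noteq> {}"
  shows "emeasure lborel A = (SUP a\<in>A. emeasure lborel (A \<inter> {..a}))"
proof (rule antisym)
  let ?K = "SUP a\<in>A. emeasure lborel (A \<inter> {..a})"
  have le: "emeasure lborel (A \<inter> {..r}) \<le> ?K" if "a \<in> A" "r \<le> a" for a r
  proof -
    have "emeasure lborel (A \<inter> {..r}) \<le> emeasure lborel (A \<inter> {..a})"
      using that by (intro emeasure_mono) auto
    also have "\<dots> \<le> ?K" using that by (intro SUP_upper)
    finally show ?thesis .
  qed
  show "emeasure lborel A \<le> ?K"
  proof (cases "bdd_above A")
    case False
    have "emeasure lborel (A \<inter> {..real n}) \<le> ?K" for n
    proof -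
      obtain a where "a \<in> A" "real n \<le> a"
        using False by (meson bdd_above.I linear)
      then show ?thesis by (rule le)
    qed
    then have "(SUP n. emeasure lborel (A \<inter> {..real n})) \<le> ?K" by (rule SUP_least)
    moreover have "(SUP n. emeasure lborel (A \<inter> {..real n})) = emeasure lborel (\<Union>n. A \<inter> {..real n})"
      by (rule SUP_emeasure_incseq) (auto simp: incseq_def)
    moreover have "(\<Union>n. A \<inter> {..real n}) = A" by (auto intro: real_arch_simple)
    ultimately show ?thesis by (simp only:)
  next
    case True
    \<comment> \<open>The supremum need not lie in \<open>A\<close>: the part below \<open>S\<close>
      is exhausted by levels \<open>S - 1 / real (Suc n)\<close>, and the point \<open>S\<close> is
      null.\<close>
    define S where "S = Sup A"
    have S: "x \<le> S" if "x \<in> A" for x using True that by (simp add: S_def cSup_upper)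
    have "emeasure lborel (A \<inter> {..S - 1 / real (Suc n)}) \<le> ?K" for n
    proof -
      have "S - 1 / real (Suc n) < Sup A" by (simp add: S_def)
      then obtain a where "a \<in> A" "S - 1 / real (Suc n) < a"
        using less_cSup_iff[OF \<open>A \<noteq> {}\<close> True] by blast
      then show ?thesis by (intro le[of a]) auto
    qed
    then have "(SUP n. emeasure lborel (A \<inter> {..S - 1 / real (Suc n)})) \<le> ?K" by (rule SUP_least)
    moreover have "(SUP n. emeasure lborel (A \<inter> {..S - 1 / real (Suc n)}))
        = emeasure lborel (\<Union>n. A \<inter> {..S - 1 / real (Suc n)})"
      by (rule SUP_emeasure_incseq) (auto simp: incseq_def field_simps intro: order_trans)
    moreover have "(\<Union>n. A \<inter> {..S - 1 / real (Suc n)}) = A \<inter> {..<S}"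
    proof (intro equalityI subsetI)
      fix x assume x: "x \<in> A \<inter> {..<S}"
      then obtain n where "inverse (real (Suc n)) < S - x"
        using reals_Archimedean[of "S - x"] by auto
      then show "x \<in> (\<Union>n. A \<inter> {..S - 1 / real (Suc n)})"
        using x by (auto intro!: exI[of _ n] simp: inverse_eq_divide)
    next
      fix x assume "x \<in> (\<Union>n. A \<inter> {..S - 1 / real (Suc n)})"
      then obtain n where "x \<in> A" "x \<le> S - 1 / real (Suc n)" by auto
      moreover have "S - 1 / real (Suc n) < S" by simp
      ultimately show "x \<in> A \<inter> {..<S}" unfolding Int_iff lessThan_iff by (blast intro: le_less_trans)
    qed
    ultimately have "emeasure lborel (A \<inter> {..<S}) \<le> ?K" by (simp only:)
    moreover have "emeasure lborel A \<le> emeasure lborel (A \<inter> {..<S}) + emeasure lborel {S}"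
    proof -
      have "emeasure lborel A \<le> emeasure lborel ((A \<inter> {..<S}) \<union> {S})"
        using S by (intro emeasure_mono) (auto simp: less_le)
      also have "\<dots> \<le> emeasure lborel (A \<inter> {..<S}) + emeasure lborel {S}"
        by (rule emeasure_subadditive) auto
      finally show ?thesis .
    qed
    ultimately show ?thesis by simp
  qed
qed (intro SUP_least emeasure_mono, auto)

lemma emeasure_eq_SUP_atLeast:
  fixes A :: "real set"
  assumes [measurable]: "A \<in> sets borel" and ne: "A \<noteq> {}"
  shows "emeasure lborel A = (SUP a\<in>A. emeasure lborel (A \<inter> {a..}))"
proof -
  let ?B = "uminus -` A :: real set"
  have B [measurable]: "?B \<in> sets borel"
    using measurable_sets[OF borel_measurable_uminus[OF measurable_ident] assms(1)]
    by (simp add: vimage_def)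
  have refl: "emeasure lborel (uminus -` X) = emeasure lborel X"
    if [measurable]: "X \<in> sets borel" for X :: "real set"
    by (subst (2) lborel_distr_uminus[symmetric]) (simp add: emeasure_distr)
  have neB: "?B \<noteq> {}" using ne by (metis empty_iff equals0I minus_minus vimageI)
  have "emeasure lborel A = (SUP a\<in>?B. emeasure lborel (?B \<inter> {..a}))"
    using emeasure_eq_SUP_atMost[OF B neB] refl[of A] by simp
  also have "\<dots> = (SUP a\<in>?B. emeasure lborel (A \<inter> {- a..}))"
  proof (intro SUP_cong refl)
    fix a assume "a \<in> ?B"
    have "?B \<inter> {..a} = uminus -` (A \<inter> {- a..})" by auto
    then show "emeasure lborel (?B \<inter> {..a}) = emeasure lborel (A \<inter> {- a..})"
      using refl[of "A \<inter> {- a..}"] by simp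
  qed auto
  also have "\<dots> = (SUP a\<in>uminus ` ?B. emeasure lborel (A \<inter> {a..}))"
    unfolding image_image ..
  also have "uminus ` ?B = A" by (auto simp: image_iff)
  finally show ?thesis .
qed

text \<open>The map taking \<open>x\<close> to \<open>(x + b) / 2\<close> halves Lebesgue measure
  and sends \<open>X\<close> into \<open>Y\<close>.\<close>

lemma emeasure_le_twice_midpoints:
  fixes X Y :: "real set"
  assumes [measurable]: "X \<in> sets borel" "Y \<in> sets borel" and "\<And>x. x \<in> X \<Longrightarrow> (x + b) / 2 \<in> Y"
  shows "emeasure lborel X \<le> 2 * emeasure lborel Y"
proof -
  have "emeasure lborel X = (\<integral>\<^sup>+x. indicator X x \<partial>lborel)" by simp
  also have "\<dots> \<le> (\<integral>\<^sup>+x. indicator Y (b / 2 + (1 / 2) * x) \<partial>lborel)"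
    using assms(3) by (intro nn_integral_mono) (auto simp: field_simps split: split_indicator)
  also have "\<dots> = 2 * (ennreal \<bar>1 / 2\<bar> * (\<integral>\<^sup>+x. indicator Y (b / 2 + (1 / 2) * x) \<partial>lborel))"
  proof -
    have "2 * ennreal \<bar>1 / 2\<bar> = ennreal (2 * (1 / 2))" by (subst ennreal_mult) auto
    then show ?thesis by (simp add: mult.assoc[symmetric])
  qed
  also have "ennreal \<bar>1 / 2\<bar> * (\<integral>\<^sup>+x. indicator Y (b / 2 + (1 / 2) * x) \<partial>lborel)
      = (\<integral>\<^sup>+x. indicator Y x \<partial>lborel)"
    by (rule nn_integral_real_affine[symmetric]) auto
  finally show ?thesis by simp
qed

text \<open>With \<open>a\<close> the maximum of the truncated \<open>A\<close> and \<open>b\<close>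
  the minimum of the truncated \<open>B\<close>, the midpoints of \<open>A\<close> with
  \<open>b\<close> lie left of \<open>(a + b) / 2\<close> and those of \<open>B\<close> with
  \<open>a\<close> right of it. Removing the null point \<open>b\<close> makes the two parts of
  \<open>C\<close> disjoint. Stating it with a covering set \<open>C\<close> leaves the
  measurability of the midpoint set out of play.\<close>

lemma brunn_minkowski_real:
  fixes A B C :: "real set"
  assumes [measurable]: "A \<in> sets borel" "B \<in> sets borel" "C \<in> sets borel"
    and ne: "A \<noteq> {}" "B \<noteq> {}" and mid: "\<And>x y. x \<in> A \<Longrightarrow> y \<in> B \<Longrightarrow> (x + y) / 2 \<in> C"
  shows "emeasure lborel A + emeasure lborel B \<le> 2 * emeasure lborel C"
proof -
  have "emeasure lborel (A \<inter> {..a}) + emeasure lborel (B \<inter> {b..}) \<le> 2 * emeasure lborel C"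
    if ab: "a \<in> A" "b \<in> B" for a b
  proof -
    let ?c = "(a + b) / 2"
    have "emeasure lborel (A \<inter> {..a}) \<le> 2 * emeasure lborel (C \<inter> {..?c})"
      using mid ab by (intro emeasure_le_twice_midpoints[where b = b]) auto
    moreover have "emeasure lborel (B \<inter> {b..}) \<le> 2 * emeasure lborel (C \<inter> {?c<..})"
    proof -
      have "emeasure lborel (B \<inter> {b..}) \<le> emeasure lborel ((B \<inter> {b<..}) \<union> {b})"
        by (intro emeasure_mono) auto
      also have "\<dots> \<le> emeasure lborel (B \<inter> {b<..}) + emeasure lborel {b}"
        by (rule emeasure_subadditive) auto
      also have "\<dots> = emeasure lborel (B \<inter> {b<..})" by simp
      also have "\<dots> \<le> 2 * emeasure lborel (C \<inter> {?c<..})"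
      proof (rule emeasure_le_twice_midpoints[where b = a])
        fix x assume "x \<in> B \<inter> {b<..}"
        then show "(x + a) / 2 \<in> C \<inter> {?c<..}"
          using mid[OF ab(1), of x] by (auto simp: add.commute)
      qed auto
      finally show ?thesis .
    qed
    moreover have "emeasure lborel (C \<inter> {..?c}) + emeasure lborel (C \<inter> {?c<..}) = emeasure lborel C"
    proof -
      have "emeasure lborel (C \<inter> {..?c}) + emeasure lborel (C \<inter> {?c<..})
          = emeasure lborel ((C \<inter> {..?c}) \<union> (C \<inter> {?c<..}))"
        by (rule plus_emeasure) auto
      also have "(C \<inter> {..?c}) \<union> (C \<inter> {?c<..}) = C" by auto
      finally show ?thesis .
    qed
    ultimately show ?thesis by (metis add_mono distrib_left)
  qed
  then have "(SUP a\<in>A. emeasure lborel (A \<inter> {..a}) + emeasure lborel (B \<inter> {b..})) \<le> 2 * emeasure lborel C"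
    if "b \<in> B" for b using that by (intro SUP_least) auto
  then have "emeasure lborel A + emeasure lborel (B \<inter> {b..}) \<le> 2 * emeasure lborel C"
    if "b \<in> B" for b
    using that ne by (simp add: ennreal_SUP_add_left emeasure_eq_SUP_atMost[symmetric])
  then have "(SUP b\<in>B. emeasure lborel A + emeasure lborel (B \<inter> {b..})) \<le> 2 * emeasure lborel C"
    by (intro SUP_least) auto
  then show ?thesis
    using ne by (simp add: ennreal_SUP_add_right[symmetric] emeasure_eq_SUP_atLeast[symmetric])
qed

lemma nn_integral_layer_cake:
  fixes w :: "real \<Rightarrow> real"
  assumes [measurable]: "w \<in> borel_measurable borel"
  shows "(\<integral>\<^sup>+x. ennreal (w x) \<partial>lborel)
    = (\<integral>\<^sup>+t. emeasure lborel {x. t < w x} * indicator {0..} t \<partial>lborel)"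
proof -
  have "(\<integral>\<^sup>+x. ennreal (w x) \<partial>lborel) = (\<integral>\<^sup>+x. (\<integral>\<^sup>+t. indicator {0..<w x} t \<partial>lborel) \<partial>lborel)"
  proof (intro nn_integral_cong)
    fix x show "ennreal (w x) = (\<integral>\<^sup>+t. indicator {0..<w x} t \<partial>lborel)"
      by (cases "0 \<le> w x") (simp_all add: ennreal_neg)
  qed
  also have "\<dots> = (\<integral>\<^sup>+x. (\<integral>\<^sup>+t. (if 0 \<le> t \<and> t < w x then 1 else 0) \<partial>lborel) \<partial>lborel)"
    by (intro nn_integral_cong) (auto split: split_indicator)
  also have "\<dots> = (\<integral>\<^sup>+t. (\<integral>\<^sup>+x. (if 0 \<le> t \<and> t < w x then 1 else 0) \<partial>lborel) \<partial>lborel)"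
    by (rule lborel_pair.Fubini') measurable
  also have "\<dots> = (\<integral>\<^sup>+t. emeasure lborel {x. t < w x} * indicator {0..} t \<partial>lborel)"
  proof (intro nn_integral_cong)
    fix t :: real
    have "(\<integral>\<^sup>+x. (if 0 \<le> t \<and> t < w x then 1 else 0) \<partial>lborel)
        = (\<integral>\<^sup>+x. indicator {x. t < w x} x * indicator {0..} t \<partial>lborel)"
      by (intro nn_integral_cong) (auto split: split_indicator)
    then show "(\<integral>\<^sup>+x. (if 0 \<le> t \<and> t < w x then 1 else 0) \<partial>lborel)
        = emeasure lborel {x. t < w x} * indicator {0..} t"
      by (simp add: nn_integral_multc)
  qed
  finally show ?thesis .
qed

text \<open>Suprema equal to 1 make the superlevel sets of \<open>u\<close> and \<open>v\<close>
  nonempty at the same levels \<open>t < 1\<close>, so Brunn-Minkowski applies level by level and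
  integrates to an additive inequality.\<close>

lemma prekopa_leindler_level_sets:
  fixes u v w :: "real \<Rightarrow> real"
  assumes [measurable]: "u \<in> borel_measurable borel" "v \<in> borel_measurable borel" "w \<in> borel_measurable borel"
    and le1: "\<And>x. u x \<le> 1" "\<And>x. v x \<le> 1"
    and sup1: "\<And>t. t < 1 \<Longrightarrow> \<exists>x. t < u x" "\<And>t. t < 1 \<Longrightarrow> \<exists>x. t < v x"
    and mid: "\<And>t x y. 0 \<le> t \<Longrightarrow> t < u x \<Longrightarrow> t < v y \<Longrightarrow> t < w ((x + y) / 2)"
  shows "(\<integral>\<^sup>+x. ennreal (u x) \<partial>lborel) + (\<integral>\<^sup>+x. ennreal (v x) \<partial>lborel) \<le> 2 * (\<integral>\<^sup>+x. ennreal (w x) \<partial>lborel)"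
proof -
  have [measurable]: "(\<lambda>t. emeasure lborel {x. t < f x}) \<in> borel_measurable borel"
    if [measurable]: "f \<in> borel_measurable borel" for f :: "real \<Rightarrow> real"
    by measurable
  have "(emeasure lborel {x. t < u x} + emeasure lborel {x. t < v x}) * indicator {0..} t
      \<le> 2 * emeasure lborel {x. t < w x} * indicator {0..} t" for t
  proof (cases "0 \<le> t \<and> t < 1")
    case True
    then have "emeasure lborel {x. t < u x} + emeasure lborel {x. t < v x} \<le> 2 * emeasure lborel {x. t < w x}"
      using sup1[of t] mid[of t] by (intro brunn_minkowski_real) auto
    then show ?thesis by (intro mult_right_mono) auto
  next
    case False
    then have "t < 0 \<or> {x. t < u x} = {} \<and> {x. t < v x} = {}"
      using le1 by (auto simp: not_less intro: order_trans)
    then show ?thesis by (auto split: split_indicator)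
  qed
  then have "(\<integral>\<^sup>+t. (emeasure lborel {x. t < u x} + emeasure lborel {x. t < v x}) * indicator {0..} t \<partial>lborel)
      \<le> (\<integral>\<^sup>+t. 2 * emeasure lborel {x. t < w x} * indicator {0..} t \<partial>lborel)"
    by (intro nn_integral_mono) auto
  then show ?thesis
    by (simp add: nn_integral_layer_cake distrib_right nn_integral_add mult.assoc nn_integral_cmult)
qed

section \<open>Maurey's inequality on the line and its tensorization\<close>

definition gauss :: "real \<Rightarrow> real measure" where
  "gauss \<sigma> = density lborel (normal_density 0 \<sigma>)"

lemma sets_gauss [measurable_cong, simp]: "sets (gauss \<sigma>) = sets borel"
  and space_gauss [simp]: "space (gauss \<sigma>) = UNIV"
  by (simp_all add: gauss_def)

lemma prob_space_gauss: "0 < \<sigma> \<Longrightarrow> prob_space (gauss \<sigma>)"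
  unfolding gauss_def by (rule prob_space_normal_density)

text \<open>This is the parallelogram identity in the exponent; it is the origin of the cost with
  constant \<open>4 * \<sigma>\<^sup>2\<close>.\<close>

lemma normal_density_mult_midpoint:
  "normal_density 0 \<sigma> x * normal_density 0 \<sigma> y * exp ((x - y)\<^sup>2 / (4 * \<sigma>\<^sup>2))
    = (normal_density 0 \<sigma> ((x + y) / 2))\<^sup>2"
proof -
  have "- (x\<^sup>2 / (2 * \<sigma>\<^sup>2)) + - (y\<^sup>2 / (2 * \<sigma>\<^sup>2)) + (x - y)\<^sup>2 / (4 * \<sigma>\<^sup>2)
      = - (((x + y) / 2)\<^sup>2 / (2 * \<sigma>\<^sup>2)) + - (((x + y) / 2)\<^sup>2 / (2 * \<sigma>\<^sup>2))"
    by (cases "\<sigma> = 0") (simp_all add: field_simps power2_eq_square)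
  then have "exp (- (x\<^sup>2 / (2 * \<sigma>\<^sup>2))) * exp (- (y\<^sup>2 / (2 * \<sigma>\<^sup>2))) * exp ((x - y)\<^sup>2 / (4 * \<sigma>\<^sup>2))
      = exp (- (((x + y) / 2)\<^sup>2 / (2 * \<sigma>\<^sup>2))) * exp (- (((x + y) / 2)\<^sup>2 / (2 * \<sigma>\<^sup>2)))"
    unfolding exp_add[symmetric] by (rule arg_cong)
  then show ?thesis
    unfolding normal_density_def power2_eq_square[of "1 / _ * _"] by (simp add: mult_ac)
qed

text \<open>The hypothesis says that \<open>u x * v y\<close> is at most the squared density at the
  midpoint, where \<open>u\<close> and \<open>v\<close> are \<open>p\<close> and \<open>q\<close>
  times the density. Boundedness makes the suprema \<open>a\<close> and \<open>b\<close> finite, so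
  both functions can be normalized to supremum 1.\<close>

lemma gauss_maurey_bounded:
  fixes p q :: "real \<Rightarrow> real"
  assumes \<sigma>: "0 < \<sigma>" and [measurable]: "p \<in> borel_measurable borel" "q \<in> borel_measurable borel"
    and p: "\<And>x. 0 \<le> p x" "\<And>x. p x \<le> K" and q: "\<And>x. 0 \<le> q x" "\<And>x. q x \<le> K"
    and pq: "\<And>x y. p x * q y \<le> exp ((x - y)\<^sup>2 / (4 * \<sigma>\<^sup>2))"
  shows "(\<integral>\<^sup>+x. ennreal (p x) \<partial>gauss \<sigma>) * (\<integral>\<^sup>+x. ennreal (q x) \<partial>gauss \<sigma>) \<le> 1"
proof -
  let ?\<phi> = "normal_density 0 \<sigma>"
  interpret G: prob_space "gauss \<sigma>" using \<sigma> by (rule prob_space_gauss)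
  define u v where "u x = p x * ?\<phi> x" and "v x = q x * ?\<phi> x" for x
  have [measurable]: "u \<in> borel_measurable borel" "v \<in> borel_measurable borel"
    unfolding u_def v_def by measurable
  have pos: "0 < ?\<phi> x" for x using \<sigma> by (rule normal_density_pos)
  have K: "0 \<le> K" using p[of 0] by linarith
  have max: "?\<phi> x \<le> ?\<phi> 0" for x
    by (simp add: normal_density_def divide_right_mono)
  have u0: "0 \<le> u x" and v0: "0 \<le> v x" for x using p q pos[of x] by (auto simp: u_def v_def)
  have ub: "bdd_above (range u)" and vb: "bdd_above (range v)"
    unfolding u_def v_def using p q max K pos
    by (auto intro!: bdd_aboveI2[where M = "K * ?\<phi> 0"] mult_mono intro: less_imp_le)
  have I: "(\<integral>\<^sup>+x. ennreal (f x) \<partial>gauss \<sigma>) = (\<integral>\<^sup>+x. ennreal (f x * ?\<phi> x) \<partial>lborel)"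
    if [measurable]: "f \<in> borel_measurable borel" and "\<And>x. 0 \<le> f x" for f
    unfolding gauss_def using that pos
    by (subst nn_integral_density) (auto simp: ennreal_mult[symmetric] mult.commute less_imp_le)
  obtain P where P: "(\<integral>\<^sup>+x. ennreal (p x) \<partial>gauss \<sigma>) = ennreal P" "0 \<le> P"
  proof -
    have "(\<integral>\<^sup>+x. ennreal (p x) \<partial>gauss \<sigma>) \<le> (\<integral>\<^sup>+x. ennreal K \<partial>gauss \<sigma>)"
      by (intro nn_integral_mono ennreal_leI p)
    then have "(\<integral>\<^sup>+x. ennreal (p x) \<partial>gauss \<sigma>) < \<infinity>"
      using G.emeasure_space_1 by (simp add: le_less_trans)
    then show ?thesis using that by (metis ennreal_cases infinity_ennreal_def less_irrefl)
  qed
  obtain Q where Q: "(\<integral>\<^sup>+x. ennreal (q x) \<partial>gauss \<sigma>) = ennreal Q" "0 \<le> Q"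
  proof -
    have "(\<integral>\<^sup>+x. ennreal (q x) \<partial>gauss \<sigma>) \<le> (\<integral>\<^sup>+x. ennreal K \<partial>gauss \<sigma>)"
      by (intro nn_integral_mono ennreal_leI q)
    then have "(\<integral>\<^sup>+x. ennreal (q x) \<partial>gauss \<sigma>) < \<infinity>"
      using G.emeasure_space_1 by (simp add: le_less_trans)
    then show ?thesis using that by (metis ennreal_cases infinity_ennreal_def less_irrefl)
  qed
  show ?thesis
  proof (cases "(\<forall>x. p x = 0) \<or> (\<forall>x. q x = 0)")
    case True
    then show ?thesis by auto
  next
    case False
    then obtain x0 y0 where "p x0 \<noteq> 0" "q y0 \<noteq> 0" by auto
    then have "0 < u x0" "0 < v y0" using p(1)[of x0] q(1)[of y0] pos by (auto simp: u_def v_def less_le)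
    define a b where "a = (SUP x. u x)" and "b = (SUP x. v x)"
    have ua: "u x \<le> a" and vb': "v x \<le> b" for x
      unfolding a_def b_def using ub vb by (auto intro: cSUP_upper)
    have a: "0 < a" and b: "0 < b" using ua[of x0] vb'[of y0] \<open>0 < u x0\<close> \<open>0 < v y0\<close> by linarith+
    have "(\<integral>\<^sup>+x. ennreal (u x / a) \<partial>lborel) + (\<integral>\<^sup>+x. ennreal (v x / b) \<partial>lborel)
       \<le> 2 * (\<integral>\<^sup>+x. ennreal (?\<phi> x / sqrt (a * b)) \<partial>lborel)"
    proof (rule prekopa_leindler_level_sets)
      fix t :: real assume "t < 1"
      then have "t * a < a" "t * b < b" using a b by auto
      then show "\<exists>x. t < u x / a" "\<exists>x. t < v x / b"
        using less_cSUP_iff[OF _ ub, of "t * a"] less_cSUP_iff[OF _ vb, of "t * b"] a b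
        unfolding a_def[symmetric] b_def[symmetric] by (auto simp: field_simps)
    next
      fix t x y :: real assume t: "0 \<le> t" "t < u x / a" "t < v y / b"
      have "t\<^sup>2 < (u x / a) * (v y / b)"
        unfolding power2_eq_square using t by (intro mult_strict_mono') auto
      also have "\<dots> = p x * q y * (?\<phi> x * ?\<phi> y) / (a * b)" by (simp add: u_def v_def mult_ac)
      also have "\<dots> \<le> exp ((x - y)\<^sup>2 / (4 * \<sigma>\<^sup>2)) * (?\<phi> x * ?\<phi> y) / (a * b)"
        using a b pos[of x] pos[of y] by (intro divide_right_mono mult_right_mono pq) auto
      also have "\<dots> = (?\<phi> ((x + y) / 2))\<^sup>2 / (a * b)"
        by (simp add: normal_density_mult_midpoint[symmetric] mult_ac)
      also have "\<dots> = (?\<phi> ((x + y) / 2) / sqrt (a * b))\<^sup>2"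
        using a b by (simp add: power_divide)
      finally show "t < ?\<phi> ((x + y) / 2) / sqrt (a * b)"
        by (rule power_less_imp_less_base) (use a b pos[of "(x + y) / 2"] in auto)
    qed (use ua vb' a b in auto)
    moreover have "(\<integral>\<^sup>+x. ennreal (u x / a) \<partial>lborel) = ennreal (P / a)"
    proof -
      have "(\<integral>\<^sup>+x. ennreal (u x / a) \<partial>lborel) = (\<integral>\<^sup>+x. ennreal (1 / a) * ennreal (u x) \<partial>lborel)"
        using a u0 by (intro nn_integral_cong) (simp add: ennreal_mult[symmetric])
      also have "\<dots> = ennreal (1 / a) * (\<integral>\<^sup>+x. ennreal (u x) \<partial>lborel)" by (rule nn_integral_cmult) auto
      also have "(\<integral>\<^sup>+x. ennreal (u x) \<partial>lborel) = ennreal P"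
        using I[of p] p P by (simp add: u_def)
      finally show ?thesis using a P by (simp add: ennreal_mult[symmetric])
    qed
    moreover have "(\<integral>\<^sup>+x. ennreal (v x / b) \<partial>lborel) = ennreal (Q / b)"
    proof -
      have "(\<integral>\<^sup>+x. ennreal (v x / b) \<partial>lborel) = (\<integral>\<^sup>+x. ennreal (1 / b) * ennreal (v x) \<partial>lborel)"
        using b v0 by (intro nn_integral_cong) (simp add: ennreal_mult[symmetric])
      also have "\<dots> = ennreal (1 / b) * (\<integral>\<^sup>+x. ennreal (v x) \<partial>lborel)" by (rule nn_integral_cmult) auto
      also have "(\<integral>\<^sup>+x. ennreal (v x) \<partial>lborel) = ennreal Q"
        using I[of q] q Q by (simp add: v_def)
      finally show ?thesis using b Q by (simp add: ennreal_mult[symmetric])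
    qed
    moreover have "(\<integral>\<^sup>+x. ennreal (?\<phi> x / sqrt (a * b)) \<partial>lborel) = ennreal (1 / sqrt (a * b))"
    proof -
      have "(\<integral>\<^sup>+x. ennreal (?\<phi> x / sqrt (a * b)) \<partial>lborel) = (\<integral>\<^sup>+x. ennreal (1 / sqrt (a * b)) \<partial>gauss \<sigma>)"
        using I[of "\<lambda>_. 1 / sqrt (a * b)"] a b by simp
      then show ?thesis using G.emeasure_space_1 by simp
    qed
    ultimately have "ennreal (P / a) + ennreal (Q / b) \<le> 2 * ennreal (1 / sqrt (a * b))" by simp
    also have "2 * ennreal (1 / sqrt (a * b)) = ennreal (2 * (1 / sqrt (a * b)))"
      using a b by (subst ennreal_mult) auto
    finally have "ennreal (P / a + Q / b) \<le> ennreal (2 * (1 / sqrt (a * b)))"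
      using P(2) Q(2) a b by simp
    then have sum: "P / a + Q / b \<le> 2 / sqrt (a * b)"
      using a b by (simp add: ennreal_le_iff)
    \<comment> \<open>The arithmetic-geometric mean inequality undoes the normalization:
      \<open>a * b\<close> cancels on both sides.\<close>
    have "4 * ((P / a) * (Q / b)) \<le> (P / a + Q / b)\<^sup>2"
      using zero_le_power2[of "P / a - Q / b"] unfolding power2_sum power2_diff by linarith
    also have "\<dots> \<le> (2 / sqrt (a * b))\<^sup>2"
      using sum P(2) Q(2) a b by (intro power_mono) auto
    also have "\<dots> = 4 / (a * b)" using a b by (simp add: power_divide)
    finally have "P * Q \<le> 1" using a b by (simp add: field_simps)
    then show ?thesis using P Q by (simp add: ennreal_mult[symmetric])
  qed
qed

text \<open>Truncation and monotone convergence remove the bound. Values in \<open>ennreal\<close>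
  are wanted because tensorization applies this to slices whose integrals are not known to be
  finite.\<close>

lemma gauss_maurey:
  fixes p q :: "real \<Rightarrow> ennreal"
  assumes \<sigma>: "0 < \<sigma>" and [measurable]: "p \<in> borel_measurable borel" "q \<in> borel_measurable borel"
    and pq: "\<And>x y. p x * q y \<le> ennreal (exp ((x - y)\<^sup>2 / (4 * \<sigma>\<^sup>2)))"
  shows "(\<integral>\<^sup>+x. p x \<partial>gauss \<sigma>) * (\<integral>\<^sup>+x. q x \<partial>gauss \<sigma>) \<le> 1"
proof -
  have approx: "(\<integral>\<^sup>+x. f x \<partial>gauss \<sigma>) = (SUP k. \<integral>\<^sup>+x. min (f x) (of_nat k) \<partial>gauss \<sigma>)"
    if [measurable]: "f \<in> borel_measurable borel" for f :: "real \<Rightarrow> ennreal"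
  proof -
    have "f x = (SUP k. min (f x) (of_nat k))" for x
      by (simp add: inf_min[symmetric] inf_SUP[symmetric] ennreal_SUP_of_nat_eq_top)
    then have "(\<integral>\<^sup>+x. f x \<partial>gauss \<sigma>) = (\<integral>\<^sup>+x. (SUP k. min (f x) (of_nat k)) \<partial>gauss \<sigma>)" by simp
    also have "\<dots> = (SUP k. \<integral>\<^sup>+x. min (f x) (of_nat k) \<partial>gauss \<sigma>)"
      by (rule nn_integral_monotone_convergence_SUP)
        (auto simp: incseq_def le_fun_def intro: min.coboundedI2)
    finally show ?thesis .
  qed
  have bounded: "(\<integral>\<^sup>+x. min (p x) (of_nat k) \<partial>gauss \<sigma>) * (\<integral>\<^sup>+x. min (q x) (of_nat l) \<partial>gauss \<sigma>) \<le> 1" for k l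
  proof -
    have fin: "min (f x) (of_nat j) = ennreal (enn2real (min (f x) (of_nat j)))"
      for f :: "real \<Rightarrow> ennreal" and x j
      by (simp add: ennreal_enn2real_if min_def)
        (metis ennreal_of_nat_eq_real_of_nat ennreal_neq_top le_cases top.extremum_uniqueI)
    have le: "enn2real (min (f x) (of_nat j)) \<le> real (max k l)" if "j \<le> max k l"
      for f :: "real \<Rightarrow> ennreal" and x j
    proof -
      have "enn2real (min (f x) (of_nat j)) \<le> real j"
        by (intro enn2real_leI) (auto simp: ennreal_of_nat_eq_real_of_nat)
      also have "\<dots> \<le> real (max k l)" using that by simp
      finally show ?thesis .
    qed
    have "(\<integral>\<^sup>+x. ennreal (enn2real (min (p x) (of_nat k))) \<partial>gauss \<sigma>)
        * (\<integral>\<^sup>+x. ennreal (enn2real (min (q x) (of_nat l))) \<partial>gauss \<sigma>) \<le> 1"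
    proof (rule gauss_maurey_bounded[OF \<sigma>, where K = "real (max k l)"])
      fix x y
      have "ennreal (enn2real (min (p x) (of_nat k)) * enn2real (min (q y) (of_nat l)))
          = min (p x) (of_nat k) * min (q y) (of_nat l)"
        by (subst ennreal_mult) (simp_all add: fin[symmetric])
      also have "\<dots> \<le> p x * q y" by (intro mult_mono) auto
      also note pq[of x y]
      finally show "enn2real (min (p x) (of_nat k)) * enn2real (min (q y) (of_nat l))
          \<le> exp ((x - y)\<^sup>2 / (4 * \<sigma>\<^sup>2))" by simp
    qed (use le in auto)
    then show ?thesis by (simp only: fin[symmetric])
  qed
  show ?thesis
    unfolding approx[of p, OF assms(2)] approx[of q, OF assms(3)]
    by (simp add: SUP_mult_left_ennreal SUP_mult_right_ennreal bounded SUP_least)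
qed

text \<open>The cost is additive over coordinates. For fixed remaining coordinates their cost
  \<open>D\<close> is moved into \<open>p\<close> as \<open>exp (- D)\<close>; the one-dimensional
  inequality then says that the inner integrals satisfy the hypothesis on \<open>I\<close>.\<close>

lemma PiM_gauss_maurey:
  fixes p q :: "('i \<Rightarrow> real) \<Rightarrow> ennreal"
  assumes \<sigma>: "0 < \<sigma>" and "finite I"
    and "p \<in> borel_measurable (PiM I (\<lambda>_. gauss \<sigma>))" "q \<in> borel_measurable (PiM I (\<lambda>_. gauss \<sigma>))"
    and "\<And>x y. x \<in> space (PiM I (\<lambda>_. gauss \<sigma>)) \<Longrightarrow> y \<in> space (PiM I (\<lambda>_. gauss \<sigma>)) \<Longrightarrow>
      p x * q y \<le> ennreal (exp ((\<Sum>i\<in>I. (x i - y i)\<^sup>2) / (4 * \<sigma>\<^sup>2)))"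
  shows "(\<integral>\<^sup>+x. p x \<partial>PiM I (\<lambda>_. gauss \<sigma>)) * (\<integral>\<^sup>+x. q x \<partial>PiM I (\<lambda>_. gauss \<sigma>)) \<le> 1"
  using assms(2-5)
proof (induction I arbitrary: p q rule: finite_induct)
  case empty
  then show ?case by (simp add: PiM_empty nn_integral_count_space_finite)
next
  case (insert i I)
  interpret G: prob_space "gauss \<sigma>" using \<sigma> by (rule prob_space_gauss)
  interpret product_sigma_finite "\<lambda>_::'i. gauss \<sigma>" by standard
  note [measurable] = insert.prems(1,2)
  let ?M = "\<lambda>J::'i set. PiM J (\<lambda>_. gauss \<sigma>)"
  have ins: "integral\<^sup>N (?M (insert i I)) f = (\<integral>\<^sup>+x. (\<integral>\<^sup>+y. f (x(i := y)) \<partial>gauss \<sigma>) \<partial>?M I)"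
    if "f \<in> borel_measurable (?M (insert i I))" for f
    using insert.hyps that by (rule product_nn_integral_insert)
  have slice: "(\<lambda>t. f (x(i := t))) \<in> borel_measurable borel"
    if [measurable]: "f \<in> borel_measurable (?M (insert i I))" and x: "x \<in> space (?M I)"
    for f :: "('i \<Rightarrow> real) \<Rightarrow> ennreal" and x
  proof -
    have "(\<lambda>t. f (x(i := t))) \<in> borel_measurable (gauss \<sigma>)"
      using x by measurable
    then show ?thesis by (simp cong: measurable_cong_sets)
  qed
  show ?case
    unfolding ins[OF insert.prems(1)] ins[OF insert.prems(2)]
  proof (rule insert.IH)
    fix x y assume x: "x \<in> space (?M I)" and y: "y \<in> space (?M I)"
    define D where "D = (\<Sum>j\<in>I. (x j - y j)\<^sup>2) / (4 * \<sigma>\<^sup>2)"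
    have "(\<integral>\<^sup>+t. ennreal (exp (- D)) * p (x(i := t)) \<partial>gauss \<sigma>) * (\<integral>\<^sup>+t. q (y(i := t)) \<partial>gauss \<sigma>) \<le> 1"
    proof (rule gauss_maurey[OF \<sigma>])
      fix s t :: real
      have sp: "z(i := r) \<in> space (?M (insert i I))" if "z \<in> space (?M I)" for z r
        using that by (auto simp: space_PiM PiE_def extensional_def)
      have "(\<Sum>j\<in>insert i I. ((x(i := s)) j - (y(i := t)) j)\<^sup>2) = (s - t)\<^sup>2 + (\<Sum>j\<in>I. (x j - y j)\<^sup>2)"
        using insert.hyps by (subst sum.insert) (auto intro!: sum.cong)
      then have "p (x(i := s)) * q (y(i := t)) \<le> ennreal (exp (((s - t)\<^sup>2 + (\<Sum>j\<in>I. (x j - y j)\<^sup>2)) / (4 * \<sigma>\<^sup>2)))"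
        using insert.prems(3)[OF sp[OF x, of s] sp[OF y, of t]] by (simp only:)
      also have "\<dots> = ennreal (exp ((s - t)\<^sup>2 / (4 * \<sigma>\<^sup>2)) * exp D)"
        by (simp add: D_def add_divide_distrib exp_add)
      finally have "ennreal (exp (- D)) * (p (x(i := s)) * q (y(i := t)))
          \<le> ennreal (exp (- D)) * ennreal (exp ((s - t)\<^sup>2 / (4 * \<sigma>\<^sup>2)) * exp D)"
        by (intro mult_left_mono) auto
      also have "\<dots> = ennreal (exp ((s - t)\<^sup>2 / (4 * \<sigma>\<^sup>2)))"
        by (simp add: ennreal_mult[symmetric] exp_minus)
      finally show "ennreal (exp (- D)) * p (x(i := s)) * q (y(i := t)) \<le> ennreal (exp ((s - t)\<^sup>2 / (4 * \<sigma>\<^sup>2)))"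
        by (simp add: mult.assoc)
    next
      have [measurable]: "(\<lambda>t. p (x(i := t))) \<in> borel_measurable borel"
        by (rule slice[OF insert.prems(1) x])
      show "(\<lambda>t. ennreal (exp (- D)) * p (x(i := t))) \<in> borel_measurable borel" by measurable
      show "(\<lambda>t. q (y(i := t))) \<in> borel_measurable borel" by (rule slice[OF insert.prems(2) y])
    qed
    also have "(\<integral>\<^sup>+t. ennreal (exp (- D)) * p (x(i := t)) \<partial>gauss \<sigma>)
        = ennreal (exp (- D)) * (\<integral>\<^sup>+t. p (x(i := t)) \<partial>gauss \<sigma>)"
    proof (rule nn_integral_cmult)
      show "(\<lambda>t. p (x(i := t))) \<in> borel_measurable (gauss \<sigma>)"
        unfolding measurable_cong_sets[OF sets_gauss refl] by (rule slice[OF insert.prems(1) x])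
    qed
    finally have "ennreal (exp D) * (ennreal (exp (- D)) * ((\<integral>\<^sup>+t. p (x(i := t)) \<partial>gauss \<sigma>) * (\<integral>\<^sup>+t. q (y(i := t)) \<partial>gauss \<sigma>)))
        \<le> ennreal (exp D) * 1"
      by (intro mult_left_mono) (simp_all only: mult.assoc zero_le)
    moreover have "ennreal (exp D) * ennreal (exp (- D)) = 1"
      by (simp add: ennreal_mult[symmetric] exp_minus)
    ultimately show "(\<integral>\<^sup>+t. p (x(i := t)) \<partial>gauss \<sigma>) * (\<integral>\<^sup>+t. q (y(i := t)) \<partial>gauss \<sigma>) \<le> ennreal (exp D)"
      by (simp only: mult.assoc[symmetric] mult_1_left mult_1_right)
  qed (measurable, measurable)
qed

section \<open>Maxima of random walks\<close>

text \<open>Used for the cyclic shift of a walk, for its time reversal and for the passage from the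
  full noise to a window.\<close>

lemma PiM_reindex_nat:
  assumes N: "prob_space N" and f: "inj_on f {0..<m}" "f ` {0..<m} \<subseteq> {0..<n}"
  shows "distr (PiM {0..<n} (\<lambda>_. N)) (PiM {0..<m} (\<lambda>_. N)) (\<lambda>x. \<lambda>j\<in>{0..<m}. x (f j))
    = PiM {0..<m} (\<lambda>_. N)"
  by (rule distr_PiM_reindex) (use N f in auto)

lemma measurable_reindex_nat:
  assumes "f ` {0..<m} \<subseteq> {0..<n}"
  shows "(\<lambda>x. \<lambda>j\<in>{0..<m}. x (f j)) \<in> measurable (PiM {0..<n} (\<lambda>_. N)) (PiM {0..<m} (\<lambda>_. N))"
proof (rule measurable_restrict)
  fix j assume "j \<in> {0..<m}"
  then have "f j \<in> {0..<n}" using assms by blast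
  then show "(\<lambda>x. x (f j)) \<in> measurable (PiM {0..<n} (\<lambda>_. N)) N" by measurable
qed

text \<open>The empty sum \<open>k = 0\<close> is included, so the maximum is nonnegative. The step
  function \<open>h\<close> stays general because the steps \<open>r - c\<close> and
  \<open>- r - c\<close> both occur.\<close>

definition walk_max :: "(real \<Rightarrow> real) \<Rightarrow> nat \<Rightarrow> (nat \<Rightarrow> real) \<Rightarrow> real" where
  "walk_max h m x = Max ((\<lambda>k. \<Sum>j<k. h (x j)) ` {..m})"

lemma walk_max_ge: "k \<le> m \<Longrightarrow> (\<Sum>j<k. h (x j)) \<le> walk_max h m x"
  unfolding walk_max_def by (intro Max_ge) auto

lemma walk_max_nonneg: "0 \<le> walk_max h m x"
  using walk_max_ge[of 0 m h x] by simp

lemma walk_max_le: "(\<And>k. k \<le> m \<Longrightarrow> (\<Sum>j<k. h (x j)) \<le> b) \<Longrightarrow> walk_max h m x \<le> b"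
  unfolding walk_max_def by (intro Max.boundedI) auto

lemma walk_max_cong: "(\<And>j. j < m \<Longrightarrow> x j = y j) \<Longrightarrow> walk_max h m x = walk_max h m y"
  unfolding walk_max_def by (intro arg_cong[where f = Max] image_cong refl sum.cong) auto

lemma walk_max_Suc_nonpos:
  assumes "(\<Sum>j<Suc m. h (x j)) \<le> 0"
  shows "walk_max h (Suc m) x = walk_max h m x"
proof (rule antisym)
  show "walk_max h (Suc m) x \<le> walk_max h m x"
  proof (rule walk_max_le)
    fix k assume "k \<le> Suc m"
    then consider "k \<le> m" | "k = Suc m" by linarith
    then show "(\<Sum>j<k. h (x j)) \<le> walk_max h m x"
    proof cases
      case 2
      with assms have "(\<Sum>j<k. h (x j)) \<le> 0" by (simp only:)
      also note walk_max_nonneg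
      finally show ?thesis .
    qed (rule walk_max_ge)
  qed
qed (intro walk_max_le walk_max_ge, simp)

text \<open>A positive full sum beats the empty one, so only nonempty partial sums matter, and all
  of them contain the first step.\<close>

lemma walk_max_Suc_pos:
  assumes "0 < (\<Sum>j<Suc m. h (x j))"
  shows "walk_max h (Suc m) x = h (x 0) + walk_max h m (\<lambda>j. x (Suc j))"
proof (rule antisym)
  show "walk_max h (Suc m) x \<le> h (x 0) + walk_max h m (\<lambda>j. x (Suc j))"
  proof (rule walk_max_le)
    fix k assume k: "k \<le> Suc m"
    have shift: "(\<Sum>j<Suc l. h (x j)) \<le> h (x 0) + walk_max h m (\<lambda>j. x (Suc j))" if "l \<le> m" for l
      using walk_max_ge[OF that, of h "\<lambda>j. x (Suc j)"] unfolding sum.lessThan_Suc_shift by simp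
    show "(\<Sum>j<k. h (x j)) \<le> h (x 0) + walk_max h m (\<lambda>j. x (Suc j))"
    proof (cases k)
      case 0
      then show ?thesis using shift[of m] assms by simp
    next
      case (Suc l)
      then show ?thesis using shift[of l] k by simp
    qed
  qed
  have "walk_max h m (\<lambda>j. x (Suc j)) \<le> walk_max h (Suc m) x - h (x 0)"
  proof (rule walk_max_le)
    fix k assume "k \<le> m"
    then have "(\<Sum>j<Suc k. h (x j)) \<le> walk_max h (Suc m) x" by (intro walk_max_ge) simp
    then show "(\<Sum>j<k. h (x (Suc j))) \<le> walk_max h (Suc m) x - h (x 0)"
      unfolding sum.lessThan_Suc_shift by simp
  qed
  then show "h (x 0) + walk_max h m (\<lambda>j. x (Suc j)) \<le> walk_max h (Suc m) x" by simp
qed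

context
  fixes N :: "real measure" and h :: "real \<Rightarrow> real" and n :: nat
  assumes N: "prob_space N" and sets_N [measurable_cong]: "sets N = sets borel"
    and h [measurable]: "h \<in> borel_measurable borel" and int_h: "integrable N h"
begin

interpretation product_prob_space "\<lambda>_::nat. N" "{0..<n}"
  unfolding product_prob_space_def product_prob_space_axioms_def product_sigma_finite_def
  using N by (auto intro: prob_space_imp_sigma_finite)

lemma measurable_component_sum [measurable]:
  "k \<le> n \<Longrightarrow> (\<lambda>x. \<Sum>j<k. h (x j)) \<in> borel_measurable (PiM {0..<n} (\<lambda>_. N))"
  by (intro borel_measurable_sum) auto

lemma measurable_walk_max [measurable]:
  "m \<le> n \<Longrightarrow> walk_max h m \<in> borel_measurable (PiM {0..<n} (\<lambda>_. N))"
  unfolding walk_max_def[abs_def] by (intro borel_measurable_Max measurable_component_sum) auto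

lemma integrable_component:
  assumes "i < n"
  shows "integrable (PiM {0..<n} (\<lambda>_. N)) (\<lambda>x. h (x i))"
proof -
  have "integrable (distr (PiM {0..<n} (\<lambda>_. N)) N (\<lambda>x. x i)) h"
    using PiM_component[of i] int_h assms by simp
  then show ?thesis using assms by (subst (asm) integrable_distr_eq) auto
qed

lemma integrable_component_sum:
  "k \<le> n \<Longrightarrow> integrable (PiM {0..<n} (\<lambda>_. N)) (\<lambda>x. \<Sum>j<k. h (x j))"
  by (intro Bochner_Integration.integrable_sum integrable_component) auto

lemma integrable_walk_max:
  assumes m: "m \<le> n"
  shows "integrable (PiM {0..<n} (\<lambda>_. N)) (walk_max h m)"
proof (rule Bochner_Integration.integrable_bound)
  show "integrable (PiM {0..<n} (\<lambda>_. N)) (\<lambda>x. \<Sum>j<m. \<bar>h (x j)\<bar>)"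
    using m by (intro Bochner_Integration.integrable_sum integrable_abs integrable_component) auto
  have "walk_max h m x \<le> (\<Sum>j<m. \<bar>h (x j)\<bar>)" for x
  proof (rule walk_max_le)
    fix k assume "k \<le> m"
    have "(\<Sum>j<k. h (x j)) \<le> (\<Sum>j<k. \<bar>h (x j)\<bar>)" by (intro sum_mono) auto
    also have "\<dots> \<le> (\<Sum>j<m. \<bar>h (x j)\<bar>)" using \<open>k \<le> m\<close> by (intro sum_mono2) auto
    finally show "(\<Sum>j<k. h (x j)) \<le> (\<Sum>j<m. \<bar>h (x j)\<bar>)" .
  qed
  then show "AE x in PiM {0..<n} (\<lambda>_. N). norm (walk_max h m x) \<le> norm (\<Sum>j<m. \<bar>h (x j)\<bar>)"
    using walk_max_nonneg[of h m] by (auto simp: sum_nonneg)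
qed (use m in measurable)

text \<open>Kac's cyclic shift argument: on the event that the full sum is positive, the maximum is
  attained after the first step, and moving that step to the end preserves law and full sum.\<close>

lemma expectation_walk_max_Suc:
  assumes m: "Suc l \<le> n"
  shows "(\<integral>x. walk_max h (Suc l) x \<partial>PiM {0..<n} (\<lambda>_. N)) = (\<integral>x. walk_max h l x \<partial>PiM {0..<n} (\<lambda>_. N))
    + (\<integral>x. max 0 (\<Sum>j<Suc l. h (x j)) \<partial>PiM {0..<n} (\<lambda>_. N)) / real (Suc l)"
proof -
  let ?M = "PiM {0..<n} (\<lambda>_. N)"
  define m where "m = Suc l"
  define f where "f j = (if j < l then Suc j else if j = l then 0 else j)" for j
  have m_le: "m \<le> n" "0 < m" using m by (simp_all add: m_def)
  have inj: "inj_on f {0..<n}" by (rule inj_onI) (simp add: f_def split: if_splits)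
  have ran: "f ` {0..<n} \<subseteq> {0..<n}" using m_le by (auto simp: f_def m_def)
  define T where "T x = (\<lambda>j\<in>{0..<n}. x (f j))" for x :: "nat \<Rightarrow> real"
  have T [measurable]: "T \<in> measurable ?M ?M" unfolding T_def[abs_def] by (rule measurable_reindex_nat[OF ran])
  have T_distr: "distr ?M ?M T = ?M" unfolding T_def[abs_def] by (rule PiM_reindex_nat[OF N inj ran])
  have T_int: "(\<integral>x. g (T x) \<partial>?M) = (\<integral>x. g x \<partial>?M)" if [measurable]: "g \<in> borel_measurable ?M" for g :: "_ \<Rightarrow> real"
    by (subst (2) T_distr[symmetric]) (simp add: integral_distr)
  define S where "S x = (\<Sum>j<m. h (x j))" for x
  have [measurable]: "S \<in> borel_measurable ?M" unfolding S_def[abs_def] using m_le by measurable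
  have T_step: "T x j = x (Suc j)" if "j < l" for x j
    using that m_le by (simp add: T_def f_def m_def)
  have T_last: "T x l = x 0" for x
    using m_le by (simp add: T_def f_def m_def)
  have ST: "S (T x) = S x" for x
  proof -
    have "S (T x) = (\<Sum>j<l. h (x (Suc j))) + h (x 0)"
      unfolding S_def m_def by (simp add: T_step T_last)
    also have "\<dots> = S x" unfolding S_def m_def unfolding sum.lessThan_Suc_shift by simp
    finally show ?thesis .
  qed
  define P :: "(nat \<Rightarrow> real) \<Rightarrow> real" where "P x = (if 0 < S x then 1 else 0)" for x
  have [measurable]: "P \<in> borel_measurable ?M" unfolding P_def[abs_def] by measurable
  have PT: "P (T x) = P x" for x by (simp add: P_def ST)
  have [measurable]: "walk_max h l \<in> borel_measurable ?M" using m_le by (auto simp: m_def)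
  have int_ind: "integrable ?M (\<lambda>x. P x * g x)" if "integrable ?M g" for g
    using that by (rule Bochner_Integration.integrable_bound)
      (use that in \<open>auto simp: P_def[abs_def] intro!: borel_measurable_times\<close>)
  have int_l: "integrable ?M (walk_max h l)" using m_le by (intro integrable_walk_max) (simp add: m_def)
  \<comment> \<open>\<open>P\<close> depends on the full sum only, hence is invariant under
    \<open>T\<close>. In expectation the two terms with \<open>walk_max h l\<close> and
    \<open>P\<close> cancel, leaving the first step on the event of a positive sum.\<close>
  have decomp: "walk_max h m x = (walk_max h l x - P x * walk_max h l x)
      + (P x * h (x 0) + P (T x) * walk_max h l (T x))" for x
  proof (cases "0 < S x")
    case True
    have "walk_max h l (T x) = walk_max h l (\<lambda>j. x (Suc j))"
      by (rule walk_max_cong) (rule T_step)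
    then show ?thesis
      using True walk_max_Suc_pos[of h x l, folded m_def] by (simp add: PT) (simp add: P_def S_def)
  next
    case False
    then show ?thesis
      using walk_max_Suc_nonpos[of h x l, folded m_def] by (simp add: PT) (simp add: P_def S_def)
  qed
  have int_TW: "integrable ?M (\<lambda>x. P (T x) * walk_max h l (T x))"
  proof -
    have "integrable (distr ?M ?M T) (\<lambda>x. P x * walk_max h l x)"
      unfolding T_distr by (rule int_ind[OF int_l])
    then show ?thesis by (subst (asm) integrable_distr_eq) auto
  qed
  have int_c: "integrable ?M (\<lambda>x. P x * h (x i))" if "i < n" for i
    by (rule int_ind[OF integrable_component[OF that]])
  have "(\<integral>x. walk_max h m x \<partial>?M) = (\<integral>x. walk_max h l x \<partial>?M) - (\<integral>x. P x * walk_max h l x \<partial>?M)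
      + ((\<integral>x. P x * h (x 0) \<partial>?M) + (\<integral>x. P (T x) * walk_max h l (T x) \<partial>?M))"
    unfolding decomp
    using int_l int_ind[OF int_l] int_TW int_c[of 0] m_le
    by simp
  also have "(\<integral>x. P (T x) * walk_max h l (T x) \<partial>?M) = (\<integral>x. P x * walk_max h l x \<partial>?M)"
    by (rule T_int) measurable
  finally have step: "(\<integral>x. walk_max h m x \<partial>?M) = (\<integral>x. walk_max h l x \<partial>?M) + (\<integral>x. P x * h (x 0) \<partial>?M)"
    by simp
  \<comment> \<open>By the same shift each step has the same mean on this event, so that mean is the
    \<open>m\<close>-th part of the mean of the positive part of the sum.\<close>
  have same: "(\<integral>x. P x * h (x i) \<partial>?M) = (\<integral>x. P x * h (x 0) \<partial>?M)" if "i < m" for i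
    using that
  proof (induction i)
    case (Suc i)
    then have i: "i < l" "i < n" using m_le by (auto simp: m_def)
    have "(\<integral>x. P x * h (x (Suc i)) \<partial>?M) = (\<integral>x. P (T x) * h (T x i) \<partial>?M)"
      using i by (simp add: T_step PT)
    also have "\<dots> = (\<integral>x. P x * h (x i) \<partial>?M)"
      by (intro T_int borel_measurable_integrable int_c i)
    finally show ?case using Suc by simp
  qed simp
  have "(\<integral>x. max 0 (S x) \<partial>?M) = (\<integral>x. (\<Sum>i<m. P x * h (x i)) \<partial>?M)"
    by (intro Bochner_Integration.integral_cong refl)
      (auto simp: P_def S_def sum_distrib_left[symmetric])
  also have "\<dots> = (\<Sum>i<m. \<integral>x. P x * h (x i) \<partial>?M)"
    using m_le by (intro Bochner_Integration.integral_sum int_c) auto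
  also have "\<dots> = real m * (\<integral>x. P x * h (x 0) \<partial>?M)"
    using sum.cong[OF refl, of "{..<m}", OF same] by simp
  finally have eq: "(\<integral>x. max 0 (S x) \<partial>?M) = real m * (\<integral>x. P x * h (x 0) \<partial>?M)" .
  have "(\<integral>x. P x * h (x 0) \<partial>?M) = (\<integral>x. max 0 (S x) \<partial>?M) / real m"
    unfolding eq using m_le by simp
  then show ?thesis using step unfolding S_def m_def by simp
qed

text \<open>Spitzer's identity for the first moment, by telescoping. The ambient dimension
  \<open>n\<close> is fixed while the walk length varies, so the induction stays on one probability
  space.\<close>

lemma expectation_walk_max:
  "m \<le> n \<Longrightarrow> (\<integral>x. walk_max h m x \<partial>PiM {0..<n} (\<lambda>_. N))
    = (\<Sum>k<m. (\<integral>x. max 0 (\<Sum>j<Suc k. h (x j)) \<partial>PiM {0..<n} (\<lambda>_. N)) / real (Suc k))"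
proof (induction m)
  case 0
  then show ?case by (simp add: walk_max_def)
next
  case (Suc m)
  then show ?case by (simp only: expectation_walk_max_Suc sum.lessThan_Suc Suc_leD)
qed

text \<open>Form suited to Fubini in the drift: the coercion to \<open>ennreal\<close> takes the
  positive part.\<close>

lemma nn_integral_walk_max:
  assumes "m \<le> n"
  shows "(\<integral>\<^sup>+x. ennreal (walk_max h m x) \<partial>PiM {0..<n} (\<lambda>_. N))
    = (\<Sum>k<m. ennreal (1 / real (Suc k)) * (\<integral>\<^sup>+x. ennreal (\<Sum>j<Suc k. h (x j)) \<partial>PiM {0..<n} (\<lambda>_. N)))"
proof -
  let ?M = "PiM {0..<n} (\<lambda>_. N)"
  have "(\<integral>\<^sup>+x. ennreal (walk_max h m x) \<partial>?M) = ennreal (\<integral>x. walk_max h m x \<partial>?M)"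
    using assms by (intro nn_integral_eq_integral integrable_walk_max) (auto simp: walk_max_nonneg)
  also have "\<dots> = (\<Sum>k<m. ennreal ((\<integral>x. max 0 (\<Sum>j<Suc k. h (x j)) \<partial>?M) / real (Suc k)))"
    unfolding expectation_walk_max[OF assms] by (rule sum_ennreal[symmetric]) simp
  also have "\<dots> = (\<Sum>k<m. ennreal (1 / real (Suc k)) * (\<integral>\<^sup>+x. ennreal (\<Sum>j<Suc k. h (x j)) \<partial>?M))"
  proof (rule sum.cong[OF refl])
    fix k assume "k \<in> {..<m}"
    then have k: "Suc k \<le> n" using assms by simp
    have "(\<integral>\<^sup>+x. ennreal (\<Sum>j<Suc k. h (x j)) \<partial>?M) = (\<integral>\<^sup>+x. ennreal (max 0 (\<Sum>j<Suc k. h (x j))) \<partial>?M)"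
      by (intro nn_integral_cong) (simp add: max_def ennreal_neg)
    also have "\<dots> = ennreal (\<integral>x. max 0 (\<Sum>j<Suc k. h (x j)) \<partial>?M)"
      by (intro nn_integral_eq_integral integrable_max integrable_component_sum[OF k]) auto
    finally show "ennreal ((\<integral>x. max 0 (\<Sum>j<Suc k. h (x j)) \<partial>?M) / real (Suc k))
        = ennreal (1 / real (Suc k)) * (\<integral>\<^sup>+x. ennreal (\<Sum>j<Suc k. h (x j)) \<partial>?M)"
      by (simp add: ennreal_mult[symmetric])
  qed
  finally show ?thesis .
qed

end

section \<open>The energy of a sequence on the nonincreasing cone\<close>

text \<open>This is the square norm of \<open>x\<close> minus the squared distance from
  \<open>x\<close> to \<open>v\<close>, so maximizing over a closed convex cone gives the squared
  norm of the projection.\<close>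

definition antitone_score :: "nat \<Rightarrow> (nat \<Rightarrow> real) \<Rightarrow> (nat \<Rightarrow> real) \<Rightarrow> real" where
  "antitone_score m v x = (\<Sum>j<m. 2 * x j * v j - (v j)\<^sup>2)"

definition rational_antitone :: "nat \<Rightarrow> (nat \<Rightarrow> real) set" where
  "rational_antitone m = {v \<in> {0..<m} \<rightarrow>\<^sub>E \<rat>. \<forall>i j. i \<le> j \<and> j < m \<longrightarrow> v j \<le> v i}"

text \<open>The squared norm of the projection of \<open>x\<close> onto the cone of nonincreasing sequences. The
  supremum is restricted to rational sequences only to make measurability immediate.\<close>

definition antitone_energy :: "nat \<Rightarrow> (nat \<Rightarrow> real) \<Rightarrow> real" where
  "antitone_energy m x = (SUP v\<in>rational_antitone m. antitone_score m v x)"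

lemma countable_rational_antitone: "countable (rational_antitone m)"
proof (rule countable_subset)
  show "rational_antitone m \<subseteq> ({0..<m} \<rightarrow>\<^sub>E \<rat>)" by (auto simp: rational_antitone_def)
  show "countable ({0..<m} \<rightarrow>\<^sub>E (\<rat> :: real set))"
    by (intro countable_PiE countable_rat) auto
qed

lemma rational_antitone_nonempty: "rational_antitone m \<noteq> {}"
proof -
  have "(\<lambda>j\<in>{0..<m}. 0) \<in> rational_antitone m" by (auto simp: rational_antitone_def)
  then show ?thesis by blast
qed

lemma antitone_score_le: "antitone_score m v x \<le> (\<Sum>j<m. (x j)\<^sup>2)"
  unfolding antitone_score_def
proof (rule sum_mono)
  fix j
  show "2 * x j * v j - (v j)\<^sup>2 \<le> (x j)\<^sup>2"
    using zero_le_power2[of "x j - v j"] unfolding power2_diff by linarith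
qed

lemma bdd_above_antitone_score: "bdd_above ((\<lambda>v. antitone_score m v x) ` A)"
  using antitone_score_le by (rule bdd_aboveI2)

text \<open>Rounding down to multiples of \<open>1 / real k\<close> keeps a sequence nonincreasing
  and converges to it, so the rational supremum dominates every real sequence of the cone.\<close>

lemma antitone_score_le_energy:
  assumes v: "\<And>i j. i \<le> j \<Longrightarrow> j < m \<Longrightarrow> v j \<le> v i"
  shows "antitone_score m v x \<le> antitone_energy m x"
proof (rule LIMSEQ_le_const2)
  let ?v = "\<lambda>k. \<lambda>j\<in>{0..<m}. of_int \<lfloor>real k * v j\<rfloor> / real k"
  have lim: "(\<lambda>k. of_int \<lfloor>real k * a\<rfloor> / real k) \<longlonglongrightarrow> a" for a :: real
  proof (rule tendsto_sandwich)
    show "\<forall>\<^sub>F k in sequentially. a - 1 / real k \<le> of_int \<lfloor>real k * a\<rfloor> / real k"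
    proof (rule eventually_sequentiallyI)
      fix k :: nat assume "1 \<le> k"
      then have "a - 1 / real k = (real k * a - 1) / real k" by (simp add: diff_divide_distrib)
      also have "\<dots> \<le> of_int \<lfloor>real k * a\<rfloor> / real k" by (intro divide_right_mono) linarith+
      finally show "a - 1 / real k \<le> of_int \<lfloor>real k * a\<rfloor> / real k" .
    qed
    show "\<forall>\<^sub>F k in sequentially. of_int \<lfloor>real k * a\<rfloor> / real k \<le> a"
    proof (rule eventually_sequentiallyI)
      fix k :: nat assume "1 \<le> k"
      have "of_int \<lfloor>real k * a\<rfloor> / real k \<le> real k * a / real k" by (intro divide_right_mono) linarith+
      then show "of_int \<lfloor>real k * a\<rfloor> / real k \<le> a" using \<open>1 \<le> k\<close> by simp
    qed
    have "(\<lambda>k. a - 1 / real k) \<longlonglongrightarrow> a - 0" by (intro tendsto_intros lim_1_over_n)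
    then show "(\<lambda>k. a - 1 / real k) \<longlonglongrightarrow> a" by simp
  qed simp
  have "(\<lambda>k. \<Sum>j<m. 2 * x j * (of_int \<lfloor>real k * v j\<rfloor> / real k) - (of_int \<lfloor>real k * v j\<rfloor> / real k)\<^sup>2)
      \<longlonglongrightarrow> (\<Sum>j<m. 2 * x j * v j - (v j)\<^sup>2)"
    by (intro tendsto_intros lim)
  then show "(\<lambda>k. antitone_score m (?v k) x) \<longlonglongrightarrow> antitone_score m v x"
    by (simp add: antitone_score_def)
  have "antitone_score m (?v k) x \<le> antitone_energy m x" for k
  proof -
    \<comment> \<open>For \<open>k = 0\<close> division by zero gives the zero sequence, which also
      belongs to the set.\<close>
    have "?v k \<in> rational_antitone m"
      using v by (auto simp: rational_antitone_def intro!: divide_right_mono floor_mono mult_left_mono)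
    then show ?thesis
      unfolding antitone_energy_def by (intro cSUP_upper bdd_above_antitone_score)
  qed
  then show "\<exists>K. \<forall>k\<ge>K. antitone_score m (?v k) x \<le> antitone_energy m x" by blast
qed

lemma antitone_energy_leI:
  assumes "\<And>v. (\<And>i j. i \<le> j \<Longrightarrow> j < m \<Longrightarrow> v j \<le> v i) \<Longrightarrow> antitone_score m v x \<le> b"
  shows "antitone_energy m x \<le> b"
  unfolding antitone_energy_def
proof (rule cSUP_least[OF rational_antitone_nonempty])
  fix v assume "v \<in> rational_antitone m"
  then show "antitone_score m v x \<le> b" by (intro assms) (simp add: rational_antitone_def)
qed

lemma antitone_energy_nonneg: "0 \<le> antitone_energy m x"
  using antitone_score_le_energy[of m "\<lambda>_. 0" x] by (simp add: antitone_score_def)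

lemma antitone_energy_cong: "(\<And>j. j < m \<Longrightarrow> x j = y j) \<Longrightarrow> antitone_energy m x = antitone_energy m y"
  by (simp add: antitone_energy_def antitone_score_def)

lemma measurable_antitone_energy [measurable]:
  "antitone_energy m \<in> borel_measurable (PiM {0..<m} (\<lambda>_. gauss \<sigma>))"
proof -
  have "antitone_score m v \<in> borel_measurable (PiM {0..<m} (\<lambda>_. gauss \<sigma>))" for v
    unfolding antitone_score_def[abs_def] by (intro borel_measurable_sum) auto
  then show ?thesis
    unfolding antitone_energy_def[abs_def]
    by (intro borel_measurable_cSUP countable_rational_antitone bdd_above_antitone_score) auto
qed

text \<open>The competitor \<open>v\<close> for \<open>x\<close> is compared with
  \<open>v / 2\<close> for \<open>y\<close>, which is again nonincreasing; completing the square
  bounds the rest. It is the squared form of the fact that projecting onto a cone has a 1-Lipschitz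
  norm.\<close>

lemma antitone_energy_perturb:
  "antitone_energy m x \<le> 2 * antitone_energy m y + 2 * (\<Sum>j<m. (x j - y j)\<^sup>2)"
proof (rule antitone_energy_leI)
  fix v :: "nat \<Rightarrow> real" assume v: "\<And>i j. i \<le> j \<Longrightarrow> j < m \<Longrightarrow> v j \<le> v i"
  have "antitone_score m v x - 2 * antitone_score m (\<lambda>j. v j / 2) y
      = (\<Sum>j<m. 2 * (x j - y j) * v j - (v j)\<^sup>2 / 2)"
    unfolding antitone_score_def sum_distrib_left sum_subtractf[symmetric]
    by (intro sum.cong) (auto simp: power2_eq_square field_simps)
  also have "\<dots> \<le> (\<Sum>j<m. 2 * (x j - y j)\<^sup>2)"
  proof (rule sum_mono)
    fix j
    show "2 * (x j - y j) * v j - (v j)\<^sup>2 / 2 \<le> 2 * (x j - y j)\<^sup>2"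
      using zero_le_power2[of "2 * (x j - y j) - v j"] by (simp add: power2_eq_square algebra_simps)
  qed
  finally have "antitone_score m v x \<le> 2 * antitone_score m (\<lambda>j. v j / 2) y + 2 * (\<Sum>j<m. (x j - y j)\<^sup>2)"
    by (simp add: sum_distrib_left)
  moreover have "antitone_score m (\<lambda>j. v j / 2) y \<le> antitone_energy m y"
    by (rule antitone_score_le_energy) (use v in auto)
  ultimately show "antitone_score m v x \<le> 2 * antitone_energy m y + 2 * (\<Sum>j<m. (x j - y j)\<^sup>2)" by linarith
qed

section \<open>Layers of nonincreasing sequences and random walks\<close>

lemma down_closed_eq_lessThan:
  fixes P :: "nat \<Rightarrow> bool"
  assumes "\<And>i j. i \<le> j \<Longrightarrow> j < m \<Longrightarrow> P j \<Longrightarrow> P i"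
  obtains k where "k \<le> m" "\<And>j. j < m \<Longrightarrow> P j \<longleftrightarrow> j < k"
proof
  let ?k = "LEAST k. k = m \<or> \<not> P k"
  have L: "?k = m \<or> \<not> P ?k" by (rule LeastI[of _ m]) simp
  show "?k \<le> m" by (rule Least_le) simp
  fix j assume j: "j < m"
  show "P j \<longleftrightarrow> j < ?k"
  proof
    assume "P j"
    show "j < ?k"
    proof (rule ccontr)
      assume "\<not> j < ?k"
      then have "P ?k" using assms[of ?k j] \<open>P j\<close> j by simp
      then show False using L \<open>\<not> j < ?k\<close> j by simp
    qed
  next
    assume "j < ?k"
    from not_less_Least[OF this] show "P j" by simp
  qed
qed

text \<open>For \<open>c \<ge> 0\<close> the indices with \<open>c \<le> v j\<close> form an initial
  segment, so the left side is a partial sum of the walk with steps \<open>x j - c\<close>; for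
  \<open>c < 0\<close> it is zero.\<close>

lemma sum_antitone_superlevel_le_walk_max:
  assumes v: "\<And>i j. i \<le> j \<Longrightarrow> j < m \<Longrightarrow> v j \<le> (v i :: real)"
  shows "(\<Sum>j<m. (x j - c) * indicator {0..v j} c) \<le> walk_max (\<lambda>r. r - c) m x"
proof (cases "0 \<le> c")
  case True
  obtain k where k: "k \<le> m" "\<And>j. j < m \<Longrightarrow> c \<le> v j \<longleftrightarrow> j < k"
    by (rule down_closed_eq_lessThan[of m "\<lambda>j. c \<le> v j"]) (use v in \<open>auto intro: order_trans\<close>)
  have "(\<Sum>j<m. (x j - c) * indicator {0..v j} c) = (\<Sum>j<m. if j < k then x j - c else 0)"
    using True k(2) by (intro sum.cong) (auto split: split_indicator)
  also have "\<dots> = (\<Sum>j<k. x j - c)"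
    using k(1) by (subst sum.inter_filter[symmetric]) (auto intro!: sum.cong)
  also have "\<dots> \<le> walk_max (\<lambda>r. r - c) m x" using k(1) by (rule walk_max_ge)
  finally show ?thesis .
qed (simp add: walk_max_nonneg)

text \<open>Layer-cake decomposition of a nonincreasing \<open>v\<close>: its superlevel sets are initial segments and
  its sublevel sets final segments, so each layer is bounded by the maximum of a random walk.\<close>

lemma antitone_score_le_walk_max:
  assumes v: "\<And>i j. i \<le> j \<Longrightarrow> j < m \<Longrightarrow> v j \<le> v i"
  shows "ennreal (antitone_score m v x) \<le> 2 * (\<integral>\<^sup>+c. (ennreal (walk_max (\<lambda>r. r - c) m x)
      + ennreal (walk_max (\<lambda>r. - r - c) m (\<lambda>j. x (m - Suc j)))) * indicator {0..} c \<partial>lborel)"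
proof -
  \<comment> \<open>Integrating \<open>a - c\<close> over \<open>{0..w}\<close> gives
    \<open>a * w - w\<^sup>2 / 2\<close>, half of a score term. Negative \<open>v j\<close> enter
    through the pair \<open>- x j\<close>, \<open>- v j\<close>; for \<open>v j = 0\<close> both
    parts contribute zero.\<close>
  define g where "g c = (\<Sum>j<m. (x j - c) * indicator {0..v j} c) + (\<Sum>j<m. (- x j - c) * indicator {0..- v j} c)" for c
  have piece: "has_bochner_integral lborel (\<lambda>c. (a - c) * indicator {0..w} c) (if 0 \<le> w then a * w - w\<^sup>2 / 2 else 0)"
    for a w :: real
  proof (cases "0 \<le> w")
    case True
    have "has_bochner_integral lborel (\<lambda>c. (a - c) * indicator {0..w} c)
        ((a * w - w\<^sup>2 / 2) - (a * 0 - 0\<^sup>2 / 2))"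
      by (rule has_bochner_integral_FTC_Icc_real[OF True])
        (auto intro!: derivative_eq_intros)
    then show ?thesis using True by simp
  qed (simp add: has_bochner_integral_zero)
  have "has_bochner_integral lborel g
     ((\<Sum>j<m. if 0 \<le> v j then x j * v j - (v j)\<^sup>2 / 2 else 0)
      + (\<Sum>j<m. if 0 \<le> - v j then (- x j) * (- v j) - (- v j)\<^sup>2 / 2 else 0))"
    unfolding g_def[abs_def] by (intro has_bochner_integral_add has_bochner_integral_sum piece)
  moreover have "(\<Sum>j<m. if 0 \<le> v j then x j * v j - (v j)\<^sup>2 / 2 else 0)
      + (\<Sum>j<m. if 0 \<le> - v j then (- x j) * (- v j) - (- v j)\<^sup>2 / 2 else 0) = antitone_score m v x / 2"
    unfolding antitone_score_def sum_divide_distrib sum.distrib[symmetric]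
    by (intro sum.cong) (auto simp: field_simps)
  ultimately have g: "integrable lborel g" "(\<integral>c. g c \<partial>lborel) = antitone_score m v x / 2"
    by (auto simp: has_bochner_integral_iff)
  have g_le: "ennreal (g c) \<le> (ennreal (walk_max (\<lambda>r. r - c) m x)
      + ennreal (walk_max (\<lambda>r. - r - c) m (\<lambda>j. x (m - Suc j)))) * indicator {0..} c" for c
  proof (cases "0 \<le> c")
    case True
    \<comment> \<open>Reversing the indices makes the nondecreasing \<open>- v\<close>
      nonincreasing, so its layers are initial segments too.\<close>
    have "(\<Sum>j<m. (- x j - c) * indicator {0..- v j} c)
        = (\<Sum>j<m. (- x (m - Suc j) - c) * indicator {0..- v (m - Suc j)} c)"
      by (rule sum.nat_diff_reindex[symmetric])
    also have "\<dots> \<le> walk_max (\<lambda>r. r - c) m (\<lambda>j. - x (m - Suc j))"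
      by (rule sum_antitone_superlevel_le_walk_max) (use v in auto)
    also have "\<dots> = walk_max (\<lambda>r. - r - c) m (\<lambda>j. x (m - Suc j))" by (simp add: walk_max_def)
    finally have "g c \<le> walk_max (\<lambda>r. r - c) m x + walk_max (\<lambda>r. - r - c) m (\<lambda>j. x (m - Suc j))"
      unfolding g_def using sum_antitone_superlevel_le_walk_max[of m v x c] v by simp
    then have "ennreal (g c) \<le> ennreal (walk_max (\<lambda>r. r - c) m x + walk_max (\<lambda>r. - r - c) m (\<lambda>j. x (m - Suc j)))"
      by (rule ennreal_leI)
    then show ?thesis using True by (simp add: ennreal_plus walk_max_nonneg)
  qed (simp add: g_def)
  have "(\<integral>c. g c \<partial>lborel) \<le> (\<integral>c. max 0 (g c) \<partial>lborel)"
    using g by (intro integral_mono integrable_max) auto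
  then have "ennreal (antitone_score m v x / 2) \<le> ennreal (\<integral>c. max 0 (g c) \<partial>lborel)"
    unfolding g by (rule ennreal_leI)
  also have "\<dots> = (\<integral>\<^sup>+c. ennreal (max 0 (g c)) \<partial>lborel)"
    using g by (intro nn_integral_eq_integral[symmetric] integrable_max) auto
  also have "\<dots> = (\<integral>\<^sup>+c. ennreal (g c) \<partial>lborel)"
    by (intro nn_integral_cong) (simp add: max_def ennreal_neg)
  also have "\<dots> \<le> (\<integral>\<^sup>+c. (ennreal (walk_max (\<lambda>r. r - c) m x)
      + ennreal (walk_max (\<lambda>r. - r - c) m (\<lambda>j. x (m - Suc j)))) * indicator {0..} c \<partial>lborel)"
    by (intro nn_integral_mono g_le)
  finally have "2 * ennreal (antitone_score m v x / 2) \<le> 2 * (\<integral>\<^sup>+c. (ennreal (walk_max (\<lambda>r. r - c) m x)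
      + ennreal (walk_max (\<lambda>r. - r - c) m (\<lambda>j. x (m - Suc j)))) * indicator {0..} c \<partial>lborel)"
    by (rule mult_left_mono) simp
  moreover have "2 * ennreal (antitone_score m v x / 2) = ennreal (antitone_score m v x)"
    by (subst ennreal_numeral[symmetric]) (simp only: ennreal_mult'[symmetric], simp)
  ultimately show ?thesis by simp
qed

section \<open>Mean of the energy\<close>

lemma nn_integral_ramp:
  assumes "0 < k"
  shows "(\<integral>\<^sup>+c. ennreal (s - k * c) * indicator {0..} c \<partial>lborel) = ennreal ((max 0 s)\<^sup>2 / (2 * k))"
proof (cases "0 \<le> s")
  case True
  have "(\<integral>\<^sup>+c. ennreal (s - k * c) * indicator {0..} c \<partial>lborel)
      = (\<integral>\<^sup>+c. ennreal (s - k * c) * indicator {0..s / k} c \<partial>lborel)"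
    using assms by (intro nn_integral_cong) (auto simp: field_simps ennreal_neg split: split_indicator)
  also have "\<dots> = ennreal ((s * (s / k) - k * (s / k)\<^sup>2 / 2) - (s * 0 - k * 0\<^sup>2 / 2))"
    using assms True
    by (intro nn_integral_FTC_Icc) (auto intro!: derivative_eq_intros simp: field_simps)
  also have "(s * (s / k) - k * (s / k)\<^sup>2 / 2) - (s * 0 - k * 0\<^sup>2 / 2) = (max 0 s)\<^sup>2 / (2 * k)"
    using assms True by (simp add: field_simps power2_eq_square)
  finally show ?thesis .
next
  case False
  have "(\<integral>\<^sup>+c. ennreal (s - k * c) * indicator {0..} c \<partial>lborel) = (\<integral>\<^sup>+c. 0 \<partial>(lborel::real measure))"
  proof (intro nn_integral_cong)
    fix c :: real
    show "ennreal (s - k * c) * indicator {0..} c = 0"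
    proof (cases "0 \<le> c")
      case True
      then have "0 \<le> k * c" using assms by simp
      then have "s - k * c \<le> 0" using False by linarith
      then show ?thesis by (simp add: ennreal_neg)
    qed simp
  qed
  then show ?thesis using False by simp
qed

lemma gauss_moments:
  assumes "0 < \<sigma>"
  shows "integrable (gauss \<sigma>) (\<lambda>r. r)" "(\<integral>r. r \<partial>gauss \<sigma>) = 0"
    and "integrable (gauss \<sigma>) (\<lambda>r. r * r)" "(\<integral>r. r * r \<partial>gauss \<sigma>) = \<sigma>\<^sup>2"
  using integrable_normal_moment[OF assms, of 0 1] integral_normal_moment_odd[OF assms, of 0 0]
    integrable_normal_moment[OF assms, of 0 2] integral_normal_moment_even[OF assms, of 0 1]
  by (simp_all add: gauss_def integrable_real_density integral_real_density power2_eq_square)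

lemma second_moment_partial_sum:
  assumes \<sigma>: "0 < \<sigma>" and k: "k \<le> n"
  shows "(\<integral>\<^sup>+x. ennreal ((\<Sum>j<k. x j)\<^sup>2) \<partial>PiM {0..<n} (\<lambda>_. gauss \<sigma>)) = ennreal (real k * \<sigma>\<^sup>2)"
proof -
  let ?M = "PiM {0..<n} (\<lambda>_. gauss \<sigma>)"
  interpret G: prob_space "gauss \<sigma>" using \<sigma> by (rule prob_space_gauss)
  interpret product_sigma_finite "\<lambda>_::nat. gauss \<sigma>" by standard
  have pair: "integrable ?M (\<lambda>x. x i * x j)" "(\<integral>x. x i * x j \<partial>?M) = (if i = j then \<sigma>\<^sup>2 else 0)"
    if ij: "i < n" "j < n" for i j
  proof -
    \<comment> \<open>Writes \<open>x i * x j\<close> as a product over all coordinates, for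
      \<open>i = j\<close> and \<open>i \<noteq> j\<close> alike, so that the product integral
      formula applies.\<close>
    define f where "f l r = (if l = i then r else 1) * (if l = j then r else 1)" for l :: nat and r :: real
    have prod: "(\<Prod>l\<in>{0..<n}. f l (x l)) = x i * x j" for x
      using ij by (simp add: f_def prod.distrib prod.delta)
    have f: "integrable (gauss \<sigma>) (f l)"
      "(\<integral>r. f l r \<partial>gauss \<sigma>) = (if l = i then if l = j then \<sigma>\<^sup>2 else 0 else if l = j then 0 else 1)" for l
      unfolding f_def using gauss_moments[OF \<sigma>] G.prob_space
      by (cases "l = i"; cases "l = j"; simp)+
    show "integrable ?M (\<lambda>x. x i * x j)"
      using product_integrable_prod[of "{0..<n}" f] f by (simp add: prod)
    have "(\<integral>x. x i * x j \<partial>?M) = (\<Prod>l\<in>{0..<n}. \<integral>r. f l r \<partial>gauss \<sigma>)"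
      using product_integral_prod[of "{0..<n}" f] f by (simp add: prod)
    also have "\<dots> = (if i = j then \<sigma>\<^sup>2 else 0)"
    proof (cases "i = j")
      case True
      then have "(\<Prod>l\<in>{0..<n}. \<integral>r. f l r \<partial>gauss \<sigma>) = (\<Prod>l\<in>{0..<n}. if l = i then \<sigma>\<^sup>2 else 1)"
        by (intro prod.cong) (auto simp: f)
      then show ?thesis using True ij by (simp add: prod.delta)
    next
      case False
      have "(\<Prod>l\<in>{0..<n}. \<integral>r. f l r \<partial>gauss \<sigma>) = 0"
        using False ij by (intro prod_zero bexI[of _ i]) (auto simp: f)
      then show ?thesis using False by simp
    qed
    finally show "(\<integral>x. x i * x j \<partial>?M) = (if i = j then \<sigma>\<^sup>2 else 0)" .
  qed
  have sq: "(\<Sum>j<k. x j)\<^sup>2 = (\<Sum>i<k. \<Sum>j<k. x i * x j)" for x :: "nat \<Rightarrow> real"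
    by (simp add: power2_eq_square sum_product)
  have int: "integrable ?M (\<lambda>x. (\<Sum>j<k. x j)\<^sup>2)"
    unfolding sq using k by (intro Bochner_Integration.integrable_sum pair) auto
  have "(\<integral>x. (\<Sum>j<k. x j)\<^sup>2 \<partial>?M) = (\<Sum>i<k. \<Sum>j<k. \<integral>x. x i * x j \<partial>?M)"
    unfolding sq using k
    by (subst Bochner_Integration.integral_sum; (intro Bochner_Integration.integrable_sum pair)?)
      (auto intro!: sum.cong Bochner_Integration.integral_sum pair)
  also have "\<dots> = (\<Sum>i<k. \<Sum>j<k. if i = j then \<sigma>\<^sup>2 else 0)"
    using k by (intro sum.cong refl pair) auto
  also have "\<dots> = real k * \<sigma>\<^sup>2" by simp
  finally show ?thesis
    using int by (subst nn_integral_eq_integral) auto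
qed

text \<open>Spitzer's identity holds at fixed drift \<open>c\<close>, so the
  \<open>c\<close>-integral is moved outside first. It then goes back inside each summand, where it
  turns the positive parts of the two walks into the square of one partial sum.\<close>

lemma nn_integral_antitone_energy_le:
  assumes \<sigma>: "0 < \<sigma>"
  shows "(\<integral>\<^sup>+x. ennreal (antitone_energy m x) \<partial>PiM {0..<m} (\<lambda>_. gauss \<sigma>)) \<le> ennreal (\<sigma>\<^sup>2 * harm m)"
proof -
  let ?M = "PiM {0..<m} (\<lambda>_. gauss \<sigma>)"
  let ?r = "\<lambda>x j. x (m - Suc j)"
  interpret G: prob_space "gauss \<sigma>" using \<sigma> by (rule prob_space_gauss)
  interpret M: prob_space ?M by (intro prob_space_PiM prob_space_gauss \<sigma>)
  interpret L: pair_sigma_finite ?M "lborel :: real measure" by standard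
  define A where "A c x = ennreal (walk_max (\<lambda>r. r - c) m x)" for c x
  define B where "B c x = ennreal (walk_max (\<lambda>r. - r - c) m x)" for c x
  define S where "S k x = (\<Sum>j<Suc k. x j)" for k and x :: "nat \<Rightarrow> real"
  define F where "F k c x = (ennreal (S k x - real (Suc k) * c) + ennreal (- S k x - real (Suc k) * c)) * indicator {0..} c"
    for k c x
  have coord [measurable]: "(\<lambda>z. fst z j) \<in> borel_measurable (?M \<Otimes>\<^sub>M (lborel :: real measure))" if "j < m" for j
  proof (rule measurable_compose[OF measurable_fst])
    have "j \<in> {0..<m}" using that by simp
    then show "(\<lambda>x. x j) \<in> borel_measurable ?M" by measurable
  qed
  have S_meas [measurable]: "S k \<in> borel_measurable ?M" if "k < m" for k
    unfolding S_def[abs_def] using that by (intro borel_measurable_sum) auto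
  have Ar_meas: "(\<lambda>(x, c). (A c x + B c (?r x)) * indicator {0..} c) \<in> borel_measurable (?M \<Otimes>\<^sub>M lborel)"
  proof -
    have max: "(\<lambda>p. Max ((\<lambda>k. \<Sum>j<k. f p j) ` {..m})) \<in> borel_measurable (?M \<Otimes>\<^sub>M lborel)"
      if "\<And>j. j < m \<Longrightarrow> (\<lambda>p. f p j) \<in> borel_measurable (?M \<Otimes>\<^sub>M lborel)"
      for f :: "(nat \<Rightarrow> real) \<times> real \<Rightarrow> nat \<Rightarrow> real"
      by (intro borel_measurable_Max borel_measurable_sum that) auto
    have snd: "(\<lambda>p. snd p) \<in> borel_measurable (?M \<Otimes>\<^sub>M (lborel :: real measure))" by measurable
    have [measurable]: "(\<lambda>p. Max ((\<lambda>k. \<Sum>j<k. fst p j - snd p) ` {..m})) \<in> borel_measurable (?M \<Otimes>\<^sub>M lborel)"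
      by (intro max borel_measurable_diff coord snd)
    have [measurable]: "(\<lambda>p. Max ((\<lambda>k. \<Sum>j<k. - fst p (m - Suc j) - snd p) ` {..m})) \<in> borel_measurable (?M \<Otimes>\<^sub>M lborel)"
      by (intro max borel_measurable_diff borel_measurable_uminus coord snd) simp
    show ?thesis unfolding A_def B_def walk_max_def case_prod_beta by measurable
  qed
  have meas_x: "(\<lambda>x. walk_max h m x) \<in> borel_measurable ?M" if "h \<in> borel_measurable borel" "integrable (gauss \<sigma>) h" for h
    using that by (intro measurable_walk_max[OF prob_space_gauss[OF \<sigma>] sets_gauss]) auto
  have h1: "(\<lambda>r. r - c) \<in> borel_measurable borel" "integrable (gauss \<sigma>) (\<lambda>r. r - c)" for c :: real
    by measurable (intro Bochner_Integration.integrable_diff gauss_moments(1)[OF \<sigma>] G.integrable_const)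
  have h2: "(\<lambda>r. - r - c) \<in> borel_measurable borel" "integrable (gauss \<sigma>) (\<lambda>r. - r - c)" for c :: real
    by measurable (intro Bochner_Integration.integrable_diff Bochner_Integration.integrable_minus
        gauss_moments(1)[OF \<sigma>] G.integrable_const)
  have energy_le: "ennreal (antitone_energy m x) \<le> 2 * (\<integral>\<^sup>+c. (A c x + B c (?r x)) * indicator {0..} c \<partial>lborel)" for x
  proof (cases "2 * (\<integral>\<^sup>+c. (A c x + B c (?r x)) * indicator {0..} c \<partial>lborel)")
    case (real K)
    have "antitone_score m v x \<le> K" if "\<And>i j. i \<le> j \<Longrightarrow> j < m \<Longrightarrow> v j \<le> v i" for v
      using antitone_score_le_walk_max[of m v x, OF that] real unfolding A_def B_def
      by (simp add: ennreal_le_iff)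
    then have "antitone_energy m x \<le> K" by (rule antitone_energy_leI)
    then show ?thesis using real by (simp add: ennreal_leI)
  qed simp
  have mean: "(\<integral>\<^sup>+x. A c x + B c (?r x) \<partial>?M) * indicator {0..} c
      = (\<Sum>k<m. ennreal (1 / real (Suc k)) * (\<integral>\<^sup>+x. F k c x \<partial>?M))" for c
  proof -
    have A: "(\<integral>\<^sup>+x. A c x \<partial>?M) = (\<Sum>k<m. ennreal (1 / real (Suc k)) * (\<integral>\<^sup>+x. ennreal (S k x - real (Suc k) * c) \<partial>?M))"
      unfolding A_def nn_integral_walk_max[OF G.prob_space_axioms sets_gauss h1 order_refl]
      by (simp add: S_def sum_subtractf)
    have ran: "(\<lambda>j. m - Suc j) ` {0..<m} \<subseteq> {0..<m}" by auto
    \<comment> \<open>The reversed noise is restricted to land in the product space;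
      \<open>walk_max\<close> sees only indices below \<open>m\<close>, and reversal preserves the
      law.\<close>
    have "(\<integral>\<^sup>+x. B c (?r x) \<partial>?M) = (\<integral>\<^sup>+x. B c (\<lambda>j\<in>{0..<m}. x (m - Suc j)) \<partial>?M)"
      unfolding B_def by (intro nn_integral_cong arg_cong[where f = ennreal] walk_max_cong) simp
    also have "\<dots> = (\<integral>\<^sup>+x. B c x \<partial>distr ?M ?M (\<lambda>x. \<lambda>j\<in>{0..<m}. x (m - Suc j)))"
      unfolding B_def using meas_x[OF h2, of c]
      by (intro nn_integral_distr[symmetric] measurable_reindex_nat ran) auto
    also have "\<dots> = (\<integral>\<^sup>+x. B c x \<partial>?M)"
      by (subst PiM_reindex_nat[OF G.prob_space_axioms _ ran]) (auto simp: inj_on_def)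
    also have "\<dots> = (\<Sum>k<m. ennreal (1 / real (Suc k)) * (\<integral>\<^sup>+x. ennreal (- S k x - real (Suc k) * c) \<partial>?M))"
      unfolding B_def nn_integral_walk_max[OF G.prob_space_axioms sets_gauss h2 order_refl]
      by (simp add: S_def sum_subtractf sum_negf)
    finally have B: "(\<integral>\<^sup>+x. B c (?r x) \<partial>?M)
      = (\<Sum>k<m. ennreal (1 / real (Suc k)) * (\<integral>\<^sup>+x. ennreal (- S k x - real (Suc k) * c) \<partial>?M))" .
    have "(\<integral>\<^sup>+x. A c x + B c (?r x) \<partial>?M) = (\<integral>\<^sup>+x. A c x \<partial>?M) + (\<integral>\<^sup>+x. B c (?r x) \<partial>?M)"
    proof (rule nn_integral_add)
      show "A c \<in> borel_measurable ?M" unfolding A_def[abs_def] using meas_x[OF h1, of c] by measurable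
      have "(\<lambda>x. B c (\<lambda>j\<in>{0..<m}. x (m - Suc j))) \<in> borel_measurable ?M"
        unfolding B_def using meas_x[OF h2, of c]
        by (intro measurable_compose[OF measurable_reindex_nat[OF ran]]) auto
      moreover have "B c (\<lambda>j\<in>{0..<m}. x (m - Suc j)) = B c (?r x)" for x
        unfolding B_def by (intro arg_cong[where f = ennreal] walk_max_cong) simp
      ultimately show "(\<lambda>x. B c (?r x)) \<in> borel_measurable ?M" by simp
    qed
    also have "\<dots> * indicator {0..} c = (\<Sum>k<m. ennreal (1 / real (Suc k)) * (\<integral>\<^sup>+x. F k c x \<partial>?M))"
      unfolding A B sum.distrib[symmetric] sum_distrib_right
    proof (rule sum.cong[OF refl])
      fix k assume k: "k \<in> {..<m}"
      then have [measurable]: "S k \<in> borel_measurable ?M" by simp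
      have "(\<integral>\<^sup>+x. F k c x \<partial>?M) = ((\<integral>\<^sup>+x. ennreal (S k x - real (Suc k) * c) \<partial>?M)
          + (\<integral>\<^sup>+x. ennreal (- S k x - real (Suc k) * c) \<partial>?M)) * indicator {0..} c"
        unfolding F_def by (subst nn_integral_multc; (subst nn_integral_add)?) auto
      then show "(ennreal (1 / real (Suc k)) * (\<integral>\<^sup>+x. ennreal (S k x - real (Suc k) * c) \<partial>?M)
          + ennreal (1 / real (Suc k)) * (\<integral>\<^sup>+x. ennreal (- S k x - real (Suc k) * c) \<partial>?M)) * indicator {0..} c
          = ennreal (1 / real (Suc k)) * (\<integral>\<^sup>+x. F k c x \<partial>?M)"
        by (simp only: distrib_left distrib_right mult.assoc)
    qed
    finally show ?thesis .
  qed
  have F_meas: "(\<lambda>(x, c). F k c x) \<in> borel_measurable (?M \<Otimes>\<^sub>M lborel)" if "k < m" for k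
  proof -
    have [measurable]: "S k \<in> borel_measurable ?M" using that by (rule S_meas)
    show ?thesis unfolding F_def by measurable
  qed
  \<comment> \<open>The second moment is proportional to the length \<open>Suc k\<close> and the
    ramp divides by it, so every length contributes the same amount; the Spitzer weights alone
    produce the harmonic number.\<close>
  have level: "(\<integral>\<^sup>+c. (\<integral>\<^sup>+x. F k c x \<partial>?M) \<partial>lborel) = ennreal (\<sigma>\<^sup>2 / 2)" if k: "k < m" for k
  proof -
    have [measurable]: "S k \<in> borel_measurable ?M" using k by (rule S_meas)
    have "(\<integral>\<^sup>+c. (\<integral>\<^sup>+x. F k c x \<partial>?M) \<partial>lborel) = (\<integral>\<^sup>+x. (\<integral>\<^sup>+c. F k c x \<partial>lborel) \<partial>?M)"
      by (rule L.Fubini'[OF F_meas[OF k]])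
    also have "\<dots> = (\<integral>\<^sup>+x. ennreal (1 / (2 * real (Suc k))) * ennreal ((S k x)\<^sup>2) \<partial>?M)"
    proof (intro nn_integral_cong)
      fix x
      have "(\<integral>\<^sup>+c. F k c x \<partial>lborel)
          = (\<integral>\<^sup>+c. ennreal (S k x - real (Suc k) * c) * indicator {0..} c \<partial>lborel)
          + (\<integral>\<^sup>+c. ennreal (- S k x - real (Suc k) * c) * indicator {0..} c \<partial>lborel)"
        unfolding F_def distrib_right by (rule nn_integral_add) measurable
      also have "\<dots> = ennreal ((max 0 (S k x))\<^sup>2 / (2 * real (Suc k))) + ennreal ((max 0 (- S k x))\<^sup>2 / (2 * real (Suc k)))"
        by (simp only: nn_integral_ramp of_nat_0_less_iff zero_less_Suc)
      also have "\<dots> = ennreal ((max 0 (S k x))\<^sup>2 / (2 * real (Suc k)) + (max 0 (- S k x))\<^sup>2 / (2 * real (Suc k)))"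
        by (rule ennreal_plus[symmetric]) auto
      also have "(max 0 (S k x))\<^sup>2 / (2 * real (Suc k)) + (max 0 (- S k x))\<^sup>2 / (2 * real (Suc k))
          = 1 / (2 * real (Suc k)) * (S k x)\<^sup>2"
        by (simp add: max_def)
      also have "ennreal \<dots> = ennreal (1 / (2 * real (Suc k))) * ennreal ((S k x)\<^sup>2)"
        by (rule ennreal_mult) auto
      finally show "(\<integral>\<^sup>+c. F k c x \<partial>lborel) = ennreal (1 / (2 * real (Suc k))) * ennreal ((S k x)\<^sup>2)" .
    qed
    also have "\<dots> = ennreal (1 / (2 * real (Suc k))) * (\<integral>\<^sup>+x. ennreal ((S k x)\<^sup>2) \<partial>?M)"
      by (rule nn_integral_cmult) measurable
    also have "\<dots> = ennreal (1 / (2 * real (Suc k))) * ennreal (real (Suc k) * \<sigma>\<^sup>2)"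
      unfolding S_def using k by (simp only: second_moment_partial_sum[OF \<sigma>] Suc_leI)
    also have "\<dots> = ennreal (1 / (2 * real (Suc k)) * (real (Suc k) * \<sigma>\<^sup>2))"
      by (rule ennreal_mult[symmetric]) auto
    also have "1 / (2 * real (Suc k)) * (real (Suc k) * \<sigma>\<^sup>2) = \<sigma>\<^sup>2 / 2" by (simp add: field_simps)
    finally show ?thesis .
  qed
  have inner_meas: "(\<lambda>c. \<integral>\<^sup>+x. F k c x \<partial>?M) \<in> borel_measurable borel" if "k < m" for k
  proof -
    have [measurable]: "S k \<in> borel_measurable ?M" using that by (rule S_meas)
    show ?thesis unfolding F_def by measurable
  qed
  have "(\<integral>\<^sup>+x. ennreal (antitone_energy m x) \<partial>?M)
      \<le> (\<integral>\<^sup>+x. 2 * (\<integral>\<^sup>+c. (A c x + B c (?r x)) * indicator {0..} c \<partial>lborel) \<partial>?M)"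
    by (intro nn_integral_mono energy_le)
  also have "\<dots> = 2 * (\<integral>\<^sup>+x. (\<integral>\<^sup>+c. (A c x + B c (?r x)) * indicator {0..} c \<partial>lborel) \<partial>?M)"
    by (intro nn_integral_cmult lborel.borel_measurable_nn_integral Ar_meas)
  also have "(\<integral>\<^sup>+x. (\<integral>\<^sup>+c. (A c x + B c (?r x)) * indicator {0..} c \<partial>lborel) \<partial>?M)
      = (\<integral>\<^sup>+c. (\<integral>\<^sup>+x. (A c x + B c (?r x)) * indicator {0..} c \<partial>?M) \<partial>lborel)"
    by (rule L.Fubini'[OF Ar_meas, symmetric])
  also have "\<dots> = (\<integral>\<^sup>+c. (\<Sum>k<m. ennreal (1 / real (Suc k)) * (\<integral>\<^sup>+x. F k c x \<partial>?M)) \<partial>lborel)"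
  proof (intro nn_integral_cong)
    fix c :: real
    have "(\<integral>\<^sup>+x. (A c x + B c (?r x)) * indicator {0..} c \<partial>?M) = (\<integral>\<^sup>+x. A c x + B c (?r x) \<partial>?M) * indicator {0..} c"
      by (cases "0 \<le> c") auto
    also note mean
    finally show "(\<integral>\<^sup>+x. (A c x + B c (?r x)) * indicator {0..} c \<partial>?M)
      = (\<Sum>k<m. ennreal (1 / real (Suc k)) * (\<integral>\<^sup>+x. F k c x \<partial>?M))" .
  qed
  also have "\<dots> = (\<Sum>k<m. ennreal (1 / real (Suc k)) * (\<integral>\<^sup>+c. (\<integral>\<^sup>+x. F k c x \<partial>?M) \<partial>lborel))"
    by (subst nn_integral_sum)
      (auto intro!: sum.cong nn_integral_cmult borel_measurable_times_ennreal inner_meas)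
  also have "\<dots> = (\<Sum>k<m. ennreal (1 / real (Suc k)) * ennreal (\<sigma>\<^sup>2 / 2))"
    by (intro sum.cong) (auto simp: level)
  also have "\<dots> = (\<Sum>k<m. ennreal (1 / real (Suc k) * (\<sigma>\<^sup>2 / 2)))"
    by (intro sum.cong refl ennreal_mult[symmetric]) auto
  also have "\<dots> = ennreal (\<Sum>k<m. 1 / real (Suc k) * (\<sigma>\<^sup>2 / 2))" by (intro sum_ennreal) auto
  also have "(\<Sum>k<m. 1 / real (Suc k) * (\<sigma>\<^sup>2 / 2)) = \<sigma>\<^sup>2 * harm m / 2"
    by (simp add: harm_altdef sum_distrib_left sum_divide_distrib inverse_eq_divide)
  also have "2 * ennreal (\<sigma>\<^sup>2 * harm m / 2) = ennreal (\<sigma>\<^sup>2 * harm m)"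
    by (subst ennreal_numeral[symmetric]) (simp only: ennreal_mult'[symmetric], simp)
  finally show ?thesis by simp
qed

section \<open>Exponential moment and tail of the energy\<close>

lemma harm_le_one_plus_ln:
  assumes "1 \<le> m"
  shows "harm m \<le> 1 + ln (real m)"
proof -
  obtain k where "m = Suc k" using assms by (cases m) auto
  moreover have "harm (Suc k) - ln (real (Suc k)) \<le> harm (Suc 0) - ln (real (Suc 0))"
    using decseqD[OF decseq_harm_diff_ln, of 0 k] by simp
  ultimately show ?thesis by (simp add: harm_def)
qed

text \<open>The factor 2 before the energy of \<open>y\<close> in the perturbation bound is why the
  negative exponent is twice the positive one. Only the mean of the energy is needed to bound the
  negative moment from below.\<close>

lemma antitone_energy_exp_moment:
  assumes \<sigma>: "0 < \<sigma>"
  shows "(\<integral>\<^sup>+x. ennreal (exp (antitone_energy m x / (8 * \<sigma>\<^sup>2))) \<partial>PiM {0..<m} (\<lambda>_. gauss \<sigma>)) \<le> ennreal (exp (harm m / 4))"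
proof -
  let ?M = "PiM {0..<m} (\<lambda>_. gauss \<sigma>)"
  let ?Z = "antitone_energy m"
  interpret M: prob_space ?M by (intro prob_space_PiM prob_space_gauss \<sigma>)
  define a where "a = harm m / (4::real)"
  have fin: "(\<integral>\<^sup>+x. ennreal (?Z x) \<partial>?M) < \<infinity>"
    by (rule le_less_trans[OF nn_integral_antitone_energy_le[OF \<sigma>]]) simp
  have Z: "integrable ?M ?Z"
    using fin by (intro integrableI_nonneg) (auto simp: antitone_energy_nonneg)
  have "ennreal (\<integral>x. ?Z x \<partial>?M) \<le> ennreal (\<sigma>\<^sup>2 * harm m)"
    using nn_integral_antitone_energy_le[OF \<sigma>, of m] Z
    by (simp add: nn_integral_eq_integral antitone_energy_nonneg)
  then have EZ: "(\<integral>x. ?Z x \<partial>?M) \<le> \<sigma>\<^sup>2 * harm m"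
    by (simp add: ennreal_le_iff harm_nonneg)
  have q_int: "integrable ?M (\<lambda>x. exp (- ?Z x / (4 * \<sigma>\<^sup>2)))"
    by (rule M.integrable_const_bound[where B = 1]) (auto simp: antitone_energy_nonneg)
  text \<open>Jensen's inequality through the tangent line of \<open>exp\<close> at \<open>- a\<close>.\<close>
  have "exp (- a) \<le> (\<integral>x. exp (- a) * (1 + a - ?Z x / (4 * \<sigma>\<^sup>2)) \<partial>?M)"
  proof -
    have "(\<integral>x. exp (- a) * (1 + a - ?Z x / (4 * \<sigma>\<^sup>2)) \<partial>?M) = exp (- a) * (1 + a - (\<integral>x. ?Z x \<partial>?M) / (4 * \<sigma>\<^sup>2))"
      using Z M.prob_space by simp
    moreover have "(\<integral>x. ?Z x \<partial>?M) / (4 * \<sigma>\<^sup>2) \<le> a"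
      using EZ \<sigma> by (simp add: a_def field_simps)
    ultimately show ?thesis by simp
  qed
  also have "\<dots> \<le> (\<integral>x. exp (- ?Z x / (4 * \<sigma>\<^sup>2)) \<partial>?M)"
  proof (rule integral_mono)
    fix x
    have "exp (- a) * (1 + (a - ?Z x / (4 * \<sigma>\<^sup>2))) \<le> exp (- a) * exp (a - ?Z x / (4 * \<sigma>\<^sup>2))"
      by (intro mult_left_mono exp_ge_add_one_self) auto
    then show "exp (- a) * (1 + a - ?Z x / (4 * \<sigma>\<^sup>2)) \<le> exp (- ?Z x / (4 * \<sigma>\<^sup>2))"
      by (simp add: exp_add[symmetric] add_diff_eq)
  qed (use Z q_int in auto)
  finally have "ennreal (exp (- a)) \<le> ennreal (\<integral>x. exp (- ?Z x / (4 * \<sigma>\<^sup>2)) \<partial>?M)" by (rule ennreal_leI)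
  also have "\<dots> = (\<integral>\<^sup>+x. ennreal (exp (- ?Z x / (4 * \<sigma>\<^sup>2))) \<partial>?M)"
    by (rule nn_integral_eq_integral[OF q_int, symmetric]) simp
  finally have q: "ennreal (exp (- a)) \<le> (\<integral>\<^sup>+x. ennreal (exp (- ?Z x / (4 * \<sigma>\<^sup>2))) \<partial>?M)" .
  let ?P = "\<integral>\<^sup>+x. ennreal (exp (?Z x / (8 * \<sigma>\<^sup>2))) \<partial>?M"
  have "?P * (\<integral>\<^sup>+x. ennreal (exp (- ?Z x / (4 * \<sigma>\<^sup>2))) \<partial>?M) \<le> 1"
  proof (rule PiM_gauss_maurey[OF \<sigma>])
    fix x y
    have "?Z x / (8 * \<sigma>\<^sup>2) \<le> (2 * ?Z y + 2 * (\<Sum>j<m. (x j - y j)\<^sup>2)) / (8 * \<sigma>\<^sup>2)"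
      by (intro divide_right_mono antitone_energy_perturb) simp
    also have "\<dots> = ?Z y / (4 * \<sigma>\<^sup>2) + (\<Sum>j\<in>{0..<m}. (x j - y j)\<^sup>2) / (4 * \<sigma>\<^sup>2)"
      using \<sigma> by (simp add: field_simps lessThan_atLeast0)
    finally have "?Z x / (8 * \<sigma>\<^sup>2) + - ?Z y / (4 * \<sigma>\<^sup>2) \<le> (\<Sum>j\<in>{0..<m}. (x j - y j)\<^sup>2) / (4 * \<sigma>\<^sup>2)"
      by simp
    then show "ennreal (exp (?Z x / (8 * \<sigma>\<^sup>2))) * ennreal (exp (- ?Z y / (4 * \<sigma>\<^sup>2)))
        \<le> ennreal (exp ((\<Sum>j\<in>{0..<m}. (x j - y j)\<^sup>2) / (4 * \<sigma>\<^sup>2)))"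
      by (subst ennreal_mult[symmetric]) (simp_all only: exp_add[symmetric] exp_ge_zero ennreal_leI exp_le_cancel_iff)
  qed auto
  then have "?P * ennreal (exp (- a)) \<le> 1"
    using mult_left_mono[OF q, of ?P] by (meson order_trans zero_le)
  then have "?P * ennreal (exp (- a)) * ennreal (exp a) \<le> 1 * ennreal (exp a)"
    by (intro mult_right_mono) auto
  moreover have "ennreal (exp (- a)) * ennreal (exp a) = 1"
    by (simp add: ennreal_mult[symmetric] exp_minus)
  ultimately show ?thesis by (simp add: mult.assoc a_def)
qed

text \<open>Markov's inequality for the exponential moment at parameter
  \<open>1 / (8 * \<sigma>\<^sup>2)\<close>.\<close>

lemma antitone_energy_tail:
  assumes \<sigma>: "0 < \<sigma>"
  shows "emeasure (PiM {0..<m} (\<lambda>_. gauss \<sigma>)) {x \<in> space (PiM {0..<m} (\<lambda>_. gauss \<sigma>)). \<sigma>\<^sup>2 * b < antitone_energy m x}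
    \<le> ennreal (exp (harm m / 4 - b / 8))"
proof -
  let ?M = "PiM {0..<m} (\<lambda>_. gauss \<sigma>)"
  let ?Z = "antitone_energy m"
  let ?E = "{x \<in> space ?M. \<sigma>\<^sup>2 * b < ?Z x}"
  have "emeasure ?M ?E = (\<integral>\<^sup>+x. indicator ?E x \<partial>?M)" by (rule nn_integral_indicator[symmetric]) measurable
  also have "\<dots> \<le> (\<integral>\<^sup>+x. ennreal (exp (- b / 8)) * ennreal (exp (?Z x / (8 * \<sigma>\<^sup>2))) \<partial>?M)"
  proof (intro nn_integral_mono)
    fix x
    show "indicator ?E x \<le> ennreal (exp (- b / 8)) * ennreal (exp (?Z x / (8 * \<sigma>\<^sup>2)))"
    proof (cases "x \<in> ?E")
      case True
      then have "0 \<le> - b / 8 + ?Z x / (8 * \<sigma>\<^sup>2)" using \<sigma> by (simp add: field_simps)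
      then have "1 \<le> exp (- b / 8 + ?Z x / (8 * \<sigma>\<^sup>2))" by (simp only: one_le_exp_iff)
      then show ?thesis
        using True by (simp add: ennreal_mult[symmetric] exp_add[symmetric])
    qed simp
  qed
  also have "\<dots> = ennreal (exp (- b / 8)) * (\<integral>\<^sup>+x. ennreal (exp (?Z x / (8 * \<sigma>\<^sup>2))) \<partial>?M)"
    by (rule nn_integral_cmult) measurable
  also have "\<dots> \<le> ennreal (exp (- b / 8)) * ennreal (exp (harm m / 4))"
    by (intro mult_left_mono antitone_energy_exp_moment \<sigma>) auto
  also have "\<dots> = ennreal (exp (harm m / 4 - b / 8))"
    by (simp add: ennreal_mult[symmetric] exp_add[symmetric])
  finally show ?thesis .
qed

section \<open>The confidence bound\<close>

text \<open>Counting first occurrences turns the number of values into a sum of indicators of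
  coordinate comparisons, whose measurability is visible.\<close>

lemma num_vals_eq_sum: "real (num_vals n u) = (\<Sum>i<n. if \<forall>j<i. u j \<noteq> u i then 1 else 0)"
proof (induction n)
  case 0
  then show ?case by (simp add: num_vals_def)
next
  case (Suc n)
  have "num_vals (Suc n) u = card (insert (u n) (u ` {0..<n}))"
    by (simp add: num_vals_def atLeast0_lessThan_Suc)
  also have "\<dots> = num_vals n u + (if \<forall>j<n. u j \<noteq> u n then 1 else 0)"
    by (auto simp: num_vals_def card_insert_if) (metis atLeastLessThan_iff image_eqI zero_le)
  finally show ?case using Suc.IH by simp
qed

lemma sq_error_le_num_vals:
  fixes u w :: "nat \<Rightarrow> real"
  assumes "\<And>i. i < n \<Longrightarrow> (\<Sum>j\<in>{j. j < n \<and> u j = u i}. (w j)\<^sup>2) \<le> K"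
  shows "(\<Sum>j<n. (w j)\<^sup>2) \<le> real (num_vals n u) * K"
proof -
  have "(\<Sum>j<n. (w j)\<^sup>2) = (\<Sum>c\<in>u ` {..<n}. \<Sum>j\<in>{j \<in> {..<n}. u j = c}. (w j)\<^sup>2)"
    by (rule sum.image_gen) simp
  also have "\<dots> \<le> (\<Sum>c\<in>u ` {..<n}. K)"
  proof (rule sum_mono)
    fix c assume "c \<in> u ` {..<n}"
    then obtain i where "i < n" "c = u i" by auto
    then show "(\<Sum>j\<in>{j \<in> {..<n}. u j = c}. (w j)\<^sup>2) \<le> K" using assms[of i] by simp
  qed
  also have "\<dots> = real (num_vals n u) * K" by (simp add: num_vals_def lessThan_atLeast0)
  finally show ?thesis .
qed

text \<open>The deterministic half of the argument. Quantifying over every window makes the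
  hypothesis independent of which windows turn out to be blocks.\<close>

lemma sq_error_le_of_antitone_energy:
  assumes \<mu>: "\<forall>i j. i \<le> j \<and> j < n \<longrightarrow> \<mu> i \<le> \<mu> j"
    and energy: "\<And>s m. 1 \<le> m \<Longrightarrow> s + m \<le> n \<Longrightarrow> antitone_energy m (\<lambda>j. \<xi> (s + j)) \<le> K"
  shows "(\<Sum>i<n. (proj_mono n (\<lambda>i. \<mu> i + \<xi> i) i - \<mu> i)\<^sup>2) \<le> real (num_vals n (proj_mono n (\<lambda>i. \<mu> i + \<xi> i))) * K"
proof -
  obtain u where kkt: "isotonic_kkt n (\<lambda>i. \<mu> i + \<xi> i) u" using isotonic_kkt_exists by blast
  have "(\<Sum>j\<in>{j. j < n \<and> u j = u i}. (u j - \<mu> j)\<^sup>2) \<le> K" if i: "i < n" for i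
  proof (rule isotonic_kkt_block_error[OF kkt \<mu> i])
    fix s m
    assume sm: "s + m \<le> n" and block: "{j. j < n \<and> u j = u i} = {s..<s + m}"
      and anti: "\<And>j k. j \<le> k \<Longrightarrow> k < m \<Longrightarrow> u (s + k) - \<mu> (s + k) \<le> u (s + j) - \<mu> (s + j)"
      and err: "(\<Sum>j<m. (u (s + j) - \<mu> (s + j))\<^sup>2) \<le> (\<Sum>j<m. \<xi> (s + j) * (u (s + j) - \<mu> (s + j)))"
    have "i \<in> {s..<s + m}" unfolding block[symmetric] using i by simp
    then have m: "1 \<le> m" by simp
    have "(\<Sum>j\<in>{s..<s + m}. (u j - \<mu> j)\<^sup>2) = (\<Sum>j<m. (u (s + j) - \<mu> (s + j))\<^sup>2)"
      using sum.shift_bounds_nat_ivl[of "\<lambda>j. (u j - \<mu> j)\<^sup>2" 0 s m]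
      by (simp add: lessThan_atLeast0 add.commute)
    \<comment> \<open>The score is twice the inner product of noise and error minus the squared
      error; as the inner product dominates the squared error, so does the score dominate the inner
      product.\<close>
    also have "\<dots> \<le> antitone_score m (\<lambda>j. u (s + j) - \<mu> (s + j)) (\<lambda>j. \<xi> (s + j))"
      using err by (simp add: antitone_score_def sum_subtractf sum_distrib_left[symmetric] mult.assoc)
    also have "\<dots> \<le> antitone_energy m (\<lambda>j. \<xi> (s + j))"
      by (rule antitone_score_le_energy) (rule anti)
    also have "\<dots> \<le> K" using m sm by (rule energy)
    finally show ?thesis unfolding block .
  qed
  then have "(\<Sum>i<n. (u i - \<mu> i)\<^sup>2) \<le> real (num_vals n u) * K" by (rule sq_error_le_num_vals)
  moreover have "num_vals n (restrict u {0..<n}) = num_vals n u"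
    by (simp add: num_vals_def)
  ultimately show ?thesis unfolding proj_mono_eq[OF kkt] by simp
qed

lemma gauss_noise_eq: "gauss_noise n \<sigma> = PiM {0..<n} (\<lambda>_. gauss \<sigma>)"
  by (simp add: gauss_noise_def gauss_def)

lemma measurable_proj_mono:
  assumes "i < n"
  shows "(\<lambda>\<xi>. proj_mono n (\<lambda>i. \<mu> i + \<xi> i) i) \<in> borel_measurable (PiM {0..<n} (\<lambda>_. gauss \<sigma>))"
proof -
  let ?y = "\<lambda>\<xi> j. \<mu> j + \<xi> j :: real"
  have "proj_mono n (?y \<xi>) i
      = Max ((\<lambda>a. Min ((\<lambda>b. (\<Sum>j\<in>{a..<b}. ?y \<xi> j) / real (b - a)) ` {i<..n})) ` {..i})" for \<xi>
  proof -
    obtain u where kkt: "isotonic_kkt n (?y \<xi>) u" using isotonic_kkt_exists by blast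
    show ?thesis
      using isotonic_kkt_min_max[OF kkt assms] assms unfolding proj_mono_eq[OF kkt] by simp
  qed
  then show ?thesis
    by (simp only:) (intro borel_measurable_Max borel_measurable_Min borel_measurable_divide
        borel_measurable_sum borel_measurable_add borel_measurable_const; auto)
qed

text \<open>A window of \<open>m\<close> coordinates of the noise has the law of \<open>m\<close>
  independent copies, so the tail bound carries over by reindexing.\<close>

lemma antitone_energy_window_tail:
  assumes \<sigma>: "0 < \<sigma>" and sm: "s + m \<le> n"
  shows "{\<xi> \<in> space (PiM {0..<n} (\<lambda>_. gauss \<sigma>)). \<sigma>\<^sup>2 * b < antitone_energy m (\<lambda>j. \<xi> (s + j))}
      \<in> sets (PiM {0..<n} (\<lambda>_. gauss \<sigma>))" (is "?B \<in> _")
    and "emeasure (PiM {0..<n} (\<lambda>_. gauss \<sigma>))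
        {\<xi> \<in> space (PiM {0..<n} (\<lambda>_. gauss \<sigma>)). \<sigma>\<^sup>2 * b < antitone_energy m (\<lambda>j. \<xi> (s + j))}
      \<le> ennreal (exp (harm m / 4 - b / 8))"
proof -
  let ?M = "\<lambda>n. PiM {0..<n} (\<lambda>_. gauss \<sigma>)"
  let ?T = "\<lambda>\<xi>::nat \<Rightarrow> real. \<lambda>j\<in>{0..<m}. \<xi> (s + j)"
  let ?E = "{x \<in> space (?M m). \<sigma>\<^sup>2 * b < antitone_energy m x}"
  have ran: "(\<lambda>j. s + j) ` {0..<m} \<subseteq> {0..<n}" using sm by auto
  have T: "?T \<in> measurable (?M n) (?M m)" by (rule measurable_reindex_nat[OF ran])
  have E: "?E \<in> sets (?M m)" by measurable
  have eq: "?B = ?T -` ?E \<inter> space (?M n)"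
  proof -
    have "antitone_energy m (?T \<xi>) = antitone_energy m (\<lambda>j. \<xi> (s + j))" for \<xi>
      by (rule antitone_energy_cong) simp
    then show ?thesis using measurable_space[OF T] by auto
  qed
  show "?B \<in> sets (?M n)" unfolding eq by (rule measurable_sets[OF T E])
  have "emeasure (?M n) ?B = emeasure (distr (?M n) (?M m) ?T) ?E"
    unfolding eq by (rule emeasure_distr[OF T E, symmetric])
  also have "distr (?M n) (?M m) ?T = ?M m"
    by (rule PiM_reindex_nat[OF prob_space_gauss[OF \<sigma>] _ ran]) simp
  also note antitone_energy_tail[OF \<sigma>]
  finally show "emeasure (?M n) ?B \<le> ennreal (exp (harm m / 4 - b / 8))" .
qed

theorem mainTheorem1:
  fixes n :: nat and \<sigma> \<alpha> :: real and \<mu> :: "nat \<Rightarrow> real"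
  assumes "n \<ge> 1" and "\<sigma> > 0" and "0 < \<alpha>" and "\<alpha> < 1"
    and "\<forall>i j. i \<le> j \<and> j < n \<longrightarrow> \<mu> i \<le> \<mu> j"
  shows "measure (gauss_noise n \<sigma>)
     {\<xi> \<in> space (gauss_noise n \<sigma>).
        let y = (\<lambda>i. \<mu> i + \<xi> i); \<mu>h = proj_mono n y
        in (1 / real n) * (\<Sum>i<n. (\<mu>h i - \<mu> i)^2)
           \<le> \<sigma>^2 * real (num_vals n \<mu>h) * (2 + 22 * ln (real n) + 10 * ln (1 / \<alpha>)) / real n}
     \<ge> 1 - \<alpha>"
proof -
  let ?M = "PiM {0..<n} (\<lambda>_. gauss \<sigma>)"
  interpret M: prob_space ?M by (intro prob_space_PiM prob_space_gauss \<open>\<sigma> > 0\<close>)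
  define b where "b = 2 + 22 * ln (real n) + 10 * ln (1 / \<alpha>)"
  define p where "p \<xi> = proj_mono n (\<lambda>i. \<mu> i + \<xi> i)" for \<xi>
  define G where "G = {\<xi> \<in> space ?M. (\<Sum>i<n. (p \<xi> i - \<mu> i)\<^sup>2) \<le> real (num_vals n (p \<xi>)) * (\<sigma>\<^sup>2 * b)}"
  define bad where "bad = (\<lambda>(s, m). {\<xi> \<in> space ?M. \<sigma>\<^sup>2 * b < antitone_energy m (\<lambda>j. \<xi> (s + j))})"
  define W where "W = {(s, m). s < n \<and> 1 \<le> m \<and> m \<le> n \<and> s + m \<le> n}"
  have goal_eq: "{\<xi> \<in> space (gauss_noise n \<sigma>).
        let y = (\<lambda>i. \<mu> i + \<xi> i); \<mu>h = proj_mono n y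
        in (1 / real n) * (\<Sum>i<n. (\<mu>h i - \<mu> i)^2)
           \<le> \<sigma>^2 * real (num_vals n \<mu>h) * (2 + 22 * ln (real n) + 10 * ln (1 / \<alpha>)) / real n} = G"
    using \<open>n \<ge> 1\<close> unfolding G_def p_def b_def Let_def gauss_noise_eq
    by (simp add: divide_le_cancel mult_ac)
  have p_meas: "(\<lambda>\<xi>. p \<xi> i) \<in> borel_measurable ?M" if "i < n" for i
    unfolding p_def using that by (rule measurable_proj_mono)
  have num_meas: "(\<lambda>\<xi>. real (num_vals n (p \<xi>))) \<in> borel_measurable ?M"
    unfolding num_vals_eq_sum
  proof (rule borel_measurable_sum)
    fix i assume i: "i \<in> {..<n}"
    have "Measurable.pred ?M (\<lambda>\<xi>. \<forall>j\<in>{..<i}. p \<xi> j \<noteq> p \<xi> i)"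
    proof (rule pred_intros_finite)
      fix j assume "j \<in> {..<i}"
      then show "Measurable.pred ?M (\<lambda>\<xi>. p \<xi> j \<noteq> p \<xi> i)"
        unfolding pred_def using i by (intro borel_measurable_neq p_meas) auto
    qed simp
    then have "{\<xi> \<in> space ?M. \<forall>j<i. p \<xi> j \<noteq> p \<xi> i} \<in> sets ?M" by (simp only: pred_def Ball_def lessThan_iff)
    then show "(\<lambda>\<xi>. if \<forall>j<i. p \<xi> j \<noteq> p \<xi> i then 1 else 0 :: real) \<in> borel_measurable ?M"
      by (intro measurable_If borel_measurable_const)
  qed
  \<comment> \<open>Needed for the final monotonicity step: outside the sigma-algebra
    \<open>measure\<close> would return 0.\<close>
  have G: "G \<in> sets ?M"
  proof -
    note [measurable] = num_meas
    have [measurable]: "(\<lambda>\<xi>. \<Sum>i<n. (p \<xi> i - \<mu> i)\<^sup>2) \<in> borel_measurable ?M"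
      by (intro borel_measurable_sum borel_measurable_power borel_measurable_diff p_meas borel_measurable_const) auto
    show ?thesis unfolding G_def by measurable
  qed
  have W_sub: "W \<subseteq> {0..<n} \<times> {1..n}" by (auto simp: W_def)
  have finW: "finite W" by (rule finite_subset[OF W_sub]) simp
  have cardW: "card W \<le> n * n" using card_mono[OF _ W_sub] by simp
  have bad: "bad w \<in> sets ?M" if "w \<in> W" for w
    using that antitone_energy_window_tail(1)[OF \<open>\<sigma> > 0\<close>] by (auto simp: W_def bad_def)
  have bad_prob: "M.prob (bad w) \<le> \<alpha> / (real n)\<^sup>2" if w: "w \<in> W" for w
  proof -
    obtain s m where sm: "w = (s, m)" "1 \<le> m" "m \<le> n" "s + m \<le> n" using w by (auto simp: W_def)
    have "harm m \<le> 1 + ln (real m)" using sm by (intro harm_le_one_plus_ln)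
    also have "ln (real m) \<le> ln (real n)" using sm by simp
    finally have "harm m / 4 - b / 8 \<le> (1 + ln (real n)) / 4 - b / 8" by simp
    \<comment> \<open>The left side equals
      \<open>- (5 / 2) * ln (real n) - (5 / 4) * ln (1 / \<alpha>)\<close>: the 2 in
      \<open>b\<close> cancels the 1/4, 22/8 covers 1/4 + 2, and 10/8 covers 1.\<close>
    also have "\<dots> \<le> ln \<alpha> - 2 * ln (real n)"
    proof -
      have "0 \<le> ln (real n)" "ln \<alpha> < 0" using assms by auto
      moreover have "ln (1 / \<alpha>) = - ln \<alpha>" using assms by (simp add: ln_div)
      ultimately show ?thesis unfolding b_def by (simp add: field_simps)
    qed
    finally have "exp (harm m / 4 - b / 8) \<le> exp (ln \<alpha> - 2 * ln (real n))" by simp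
    also have "\<dots> = \<alpha> / (real n)\<^sup>2"
    proof -
      have "exp (2 * ln (real n)) = (real n)\<^sup>2"
        using assms exp_of_nat_mult[of 2 "ln (real n)"] by simp
      then show ?thesis using assms by (simp add: exp_diff)
    qed
    finally have "ennreal (exp (harm m / 4 - b / 8)) \<le> ennreal (\<alpha> / (real n)\<^sup>2)" by (rule ennreal_leI)
    moreover have "emeasure ?M (bad w) \<le> ennreal (exp (harm m / 4 - b / 8))"
      using antitone_energy_window_tail(2)[OF \<open>\<sigma> > 0\<close> sm(4)] by (simp add: bad_def sm(1))
    ultimately have "ennreal (M.prob (bad w)) \<le> ennreal (\<alpha> / (real n)\<^sup>2)"
      unfolding M.emeasure_eq_measure by (rule order_trans[rotated])
    then show ?thesis using assms by (simp add: ennreal_le_iff)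
  qed
  have sub: "space ?M - (\<Union>w\<in>W. bad w) \<subseteq> G"
  proof
    fix \<xi> assume \<xi>: "\<xi> \<in> space ?M - (\<Union>w\<in>W. bad w)"
    have "antitone_energy m (\<lambda>j. \<xi> (s + j)) \<le> \<sigma>\<^sup>2 * b" if "1 \<le> m" "s + m \<le> n" for s m
    proof -
      have "(s, m) \<in> W" using that by (simp add: W_def)
      then have "\<xi> \<notin> bad (s, m)" using \<xi> by blast
      then show ?thesis using \<xi> by (simp add: bad_def not_less)
    qed
    from sq_error_le_of_antitone_energy[OF assms(5) this] \<xi> show "\<xi> \<in> G"
      by (simp add: G_def p_def)
  qed
  have "M.prob (\<Union>w\<in>W. bad w) \<le> (\<Sum>w\<in>W. M.prob (bad w))"
    using finW bad by (intro M.finite_measure_subadditive_finite) auto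
  also have "\<dots> \<le> (\<Sum>w\<in>W. \<alpha> / (real n)\<^sup>2)" by (intro sum_mono bad_prob)
  also have "\<dots> \<le> real (n * n) * (\<alpha> / (real n)\<^sup>2)"
    using cardW assms by (simp add: divide_right_mono mult_right_mono del: of_nat_mult)
  also have "\<dots> = \<alpha>" using assms by (simp add: power2_eq_square)
  finally have "1 - \<alpha> \<le> 1 - M.prob (\<Union>w\<in>W. bad w)" by simp
  also have "\<dots> = M.prob (space ?M - (\<Union>w\<in>W. bad w))"
    using bad finW by (intro M.prob_compl[symmetric] sets.finite_UN) auto
  also have "\<dots> \<le> M.prob G" using sub G by (rule M.finite_measure_mono)
  finally show ?thesis unfolding goal_eq unfolding gauss_noise_eq .
qed

end
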